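(* Let $1<p\le2\le q<\infty$ and let $r\in(1,\infty]$ be given by $1/r=1/p-1/q$. There is a constant $c_{p,q}<\infty$ depending only on $p$ and $q$ such that for any set $X$ and any $a=(a_{ij})_{i,j\in X}\in\mathbb{C}^{X\times X}$, the Schur multiplier $A:(x_{ij})_{i,j\in X}\mapsto(a_{ij}x_{ij})_{i,j\in X}$ satisfies $$\|A:\mathcal{S}_p(\ell_2(X))\to\mathcal{S}_q(\ell_2(X))\|\le c_{p,q}\,\|a\|_{\ell_{r,\infty}(X\times X)}.$$
   Context: $\mathcal{S}_p(H)$ is the Schatten $p$-class $L_p(B(H),\mathrm{Tr})$, with norm $\|x\|_p=\mathrm{Tr}(|x|^p)^{1/p}$; an operator $x$ on $\ell_2(X)$ is identified with its matrix $(x_{ij})_{i,j\in X}$ in the canonical basis. For $a\in\mathbb{C}^{X\times X}$ and $0<r<\infty$, $\|a\|_{\ell_{r,\infty}(X\times X)}=\sup_{t>0}t^{1/r}\mu_t(a)$, where $\mu_t(a)=\inf\{s>0:|\{(i,j)\in X\times X:|a_{ij}|>s\}|<t\}$ ($|\cdot|$ = counting measure); $\|a\|_{\ell_{\infty,\infty}(X\times X)}=\sup_{i,j}|a_{ij}|$. The inequality means that, when the right side is finite, for every $x\in\mathcal{S}_p(\ell_2(X))$ the matrix $(a_{ij}x_{ij})$ defines an element of $\mathcal{S}_q(\ell_2(X))$ and the stated operator norm bound holds. *)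

theory Defs
  imports "HOL-Analysis.Analysis" "HOL-Computational_Algebra.Polynomial"
begin

section \<open>The Hilbert space \<open>\<ell>\<^sub>2(X)\<close>\<close>

text \<open>The index set \<open>X\<close> is the universe of the type variable \<open>'a\<close>.\<close>

typedef 'a ell2 = "{f :: 'a \<Rightarrow> complex. (\<lambda>i. (cmod (f i))\<^sup>2) summable_on UNIV}"
  morphisms coord Abs_ell2
  by (rule exI[of _ "\<lambda>_. 0"]) simp

setup_lifting type_definition_ell2

lemma ell2_abs_summable_prod:
  fixes f g :: "'a \<Rightarrow> complex"
  assumes "(\<lambda>i. (cmod (f i))\<^sup>2) summable_on UNIV" "(\<lambda>i. (cmod (g i))\<^sup>2) summable_on UNIV"
  shows "(\<lambda>i. cmod (cnj (f i) * g i)) summable_on UNIV"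
  by (rule abs_summable_product)
    (use assms in \<open>simp_all add: norm_mult power2_eq_square\<close>)

lemma ell2_summable_add:
  fixes f g :: "'a \<Rightarrow> complex"
  assumes f: "(\<lambda>i. (cmod (f i))\<^sup>2) summable_on UNIV" and g: "(\<lambda>i. (cmod (g i))\<^sup>2) summable_on UNIV"
  shows "(\<lambda>i. (cmod (f i + g i))\<^sup>2) summable_on UNIV"
proof (rule summable_on_comparison_test)
  show "(\<lambda>i. 2 * (cmod (f i))\<^sup>2 + 2 * (cmod (g i))\<^sup>2) summable_on UNIV"
    by (intro summable_on_add summable_on_cmult_right f g)
  show "(cmod (f i + g i))\<^sup>2 \<le> 2 * (cmod (f i))\<^sup>2 + 2 * (cmod (g i))\<^sup>2" for i
  proof -
    have "(cmod (f i + g i))\<^sup>2 \<le> (cmod (f i) + cmod (g i))\<^sup>2"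
      by (intro power_mono norm_triangle_ineq) simp
    also have "\<dots> \<le> 2 * (cmod (f i))\<^sup>2 + 2 * (cmod (g i))\<^sup>2"
      using sum_squares_bound[of "cmod (f i)" "cmod (g i)"] by (simp add: power2_sum)
    finally show ?thesis .
  qed
qed simp

lemma ell2_summable_scale:
  fixes f :: "'a \<Rightarrow> complex"
  assumes "(\<lambda>i. (cmod (f i))\<^sup>2) summable_on UNIV"
  shows "(\<lambda>i. (cmod (c * f i))\<^sup>2) summable_on UNIV"
  using summable_on_cmult_right[OF assms, of "(cmod c)\<^sup>2"]
  by (simp add: norm_mult power_mult_distrib)

lift_definition cinner :: "'a ell2 \<Rightarrow> 'a ell2 \<Rightarrow> complex"
  is "\<lambda>f g. \<Sum>\<^sub>\<infinity>i. cnj (f i) * g i" .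

lift_definition scaleC :: "complex \<Rightarrow> 'a ell2 \<Rightarrow> 'a ell2" is "\<lambda>c f i. c * f i"
  by (rule ell2_summable_scale)

lift_definition ket :: "'a \<Rightarrow> 'a ell2" is "\<lambda>i j. if j = i then 1 else 0"
proof -
  fix i :: 'a
  have "(\<lambda>j. (cmod (if j = i then 1 else 0))\<^sup>2) summable_on {i}"
    by simp
  then show "(\<lambda>j. (cmod (if j = i then 1 else 0))\<^sup>2) summable_on UNIV"
    by (rule summable_on_cong_neutral[THEN iffD1, rotated -1]) auto
qed

instantiation ell2 :: (type) real_vector
begin

lift_definition zero_ell2 :: "'a ell2" is "\<lambda>_. 0" by simp
lift_definition plus_ell2 :: "'a ell2 \<Rightarrow> 'a ell2 \<Rightarrow> 'a ell2" is "\<lambda>f g i. f i + g i"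
  by (rule ell2_summable_add)
lift_definition uminus_ell2 :: "'a ell2 \<Rightarrow> 'a ell2" is "\<lambda>f i. - f i" by simp
lift_definition minus_ell2 :: "'a ell2 \<Rightarrow> 'a ell2 \<Rightarrow> 'a ell2" is "\<lambda>f g i. f i - g i"
  subgoal for f g using ell2_summable_add[of f "\<lambda>i. - g i"] by simp
  done
lift_definition scaleR_ell2 :: "real \<Rightarrow> 'a ell2 \<Rightarrow> 'a ell2" is "\<lambda>c f i. complex_of_real c * f i"
  by (rule ell2_summable_scale)

instance
  by standard (transfer; simp add: fun_eq_iff algebra_simps; fail)+

end

instantiation ell2 :: (type) real_inner
begin

definition inner_ell2 :: "'a ell2 \<Rightarrow> 'a ell2 \<Rightarrow> real"
  where "inner_ell2 x y = Re (cinner x y)"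
definition norm_ell2 :: "'a ell2 \<Rightarrow> real"
  where "norm_ell2 x = sqrt (inner x x)"
definition sgn_ell2 :: "'a ell2 \<Rightarrow> 'a ell2"
  where "sgn_ell2 x = x /\<^sub>R norm x"
definition dist_ell2 :: "'a ell2 \<Rightarrow> 'a ell2 \<Rightarrow> real"
  where "dist_ell2 x y = norm (x - y)"
definition uniformity_ell2 :: "('a ell2 \<times> 'a ell2) filter"
  where "uniformity_ell2 = (INF e\<in>{0<..}. principal {(x, y). dist x y < e})"
definition open_ell2 :: "'a ell2 set \<Rightarrow> bool"
  where "open_ell2 U \<longleftrightarrow> (\<forall>x\<in>U. \<forall>\<^sub>F (x', y) in uniformity. x' = x \<longrightarrow> y \<in> U)"

lemma cinner_summable: "(\<lambda>i. cnj (coord x i) * coord y i) summable_on UNIV"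
  by (rule abs_summable_summable[OF ell2_abs_summable_prod])
    (use coord[of x] coord[of y] in auto)

instance
proof
  fix x y z :: "'a ell2" and c :: real
  have comm: "cinner x y = cnj (cinner y x)" for x y :: "'a ell2"
    by (simp add: cinner.rep_eq flip: infsum_cnj) (simp add: mult.commute)
  show "inner x y = inner y x"
    unfolding inner_ell2_def by (subst comm) simp
  show "inner (x + y) z = inner x z + inner y z"
    unfolding inner_ell2_def cinner.rep_eq plus_ell2.rep_eq
    by (simp add: distrib_right infsum_add cinner_summable)
  show "inner (c *\<^sub>R x) y = c * inner x y"
    unfolding inner_ell2_def cinner.rep_eq scaleR_ell2.rep_eq
    by (simp add: mult.assoc infsum_cmult_right')
  have sq: "inner x x = (\<Sum>\<^sub>\<infinity>i. (cmod (coord x i))\<^sup>2)"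
  proof -
    have "inner x x = (\<Sum>\<^sub>\<infinity>i. Re (cnj (coord x i) * coord x i))"
      unfolding inner_ell2_def cinner.rep_eq by (rule infsum_Re[symmetric, OF cinner_summable])
    also have "\<dots> = (\<Sum>\<^sub>\<infinity>i. (cmod (coord x i))\<^sup>2)"
      by (rule infsum_cong) (metis complex_norm_square mult.commute Re_complex_of_real)
    finally show ?thesis .
  qed
  show "0 \<le> inner x x"
    unfolding sq by (rule infsum_nonneg) simp
  show "inner x x = 0 \<longleftrightarrow> x = 0"
  proof
    assume "inner x x = 0"
    then have "(\<Sum>\<^sub>\<infinity>i. (cmod (coord x i))\<^sup>2) \<le> 0" by (simp add: sq)
    then have "(cmod (coord x i))\<^sup>2 = 0" for i
      by (rule nonneg_infsum_le_0D) (use coord[of x] in auto)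
    then show "x = 0"
      by (intro coord_inject[THEN iffD1]) (auto simp: zero_ell2.rep_eq)
  next
    assume "x = 0"
    then show "inner x x = 0" unfolding sq by (simp add: zero_ell2.rep_eq)
  qed
qed (fact sgn_ell2_def dist_ell2_def uniformity_ell2_def open_ell2_def norm_ell2_def)+

end

section \<open>Operators on \<open>\<ell>\<^sub>2(X)\<close> and their matrices\<close>

type_synonym 'a operator = "'a ell2 \<Rightarrow>\<^sub>L 'a ell2"

text \<open>The type \<open>'a operator\<close> consists of the bounded real-linear maps; \<open>B(\<ell>\<^sub>2(X))\<close> is its
  subset of complex-linear maps (the operator norm is the same).\<close>

definition bounded_operators :: "'a operator set"
  where "bounded_operators = {x. \<forall>c u. blinfun_apply x (scaleC c u) = scaleC c (blinfun_apply x u)}"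

definition matrix_of :: "'a operator \<Rightarrow> 'a \<Rightarrow> 'a \<Rightarrow> complex"
  where "matrix_of x i j = coord (blinfun_apply x (ket j)) i"

definition adj :: "'a operator \<Rightarrow> 'a operator"
  where "adj x = (THE y. \<forall>u v. cinner (blinfun_apply y u) v = cinner u (blinfun_apply x v))"

section \<open>Continuous functional calculus, absolute value and trace\<close>

definition poly_operator :: "real poly \<Rightarrow> 'a operator \<Rightarrow> 'a operator"
  where "poly_operator P T = (\<Sum>k\<le>degree P. coeff P k *\<^sub>R (((o\<^sub>L) T) ^^ k) id_blinfun)"

text \<open>For positive \<open>T\<close>, whose spectrum lies in \<open>[0, \<parallel>T\<parallel>]\<close>, and \<open>f\<close> continuous there, \<open>f(T)\<close> is the
  norm limit of \<open>P\<^sub>n(T)\<close> for any polynomials \<open>P\<^sub>n\<close> converging to \<open>f\<close> uniformly on \<open>[0, \<parallel>T\<parallel>]\<close>.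
  Such polynomials exist by the Weierstrass theorem, and the limit does not depend on them.\<close>

definition fun_calc :: "(real \<Rightarrow> real) \<Rightarrow> 'a operator \<Rightarrow> 'a operator"
  where "fun_calc f T = (THE S. \<forall>P :: nat \<Rightarrow> real poly.
    uniform_limit {0..norm T} (\<lambda>n. poly (P n)) f sequentially \<longrightarrow>
    (\<lambda>n. poly_operator (P n) T) \<longlonglongrightarrow> S)"

definition abs_operator :: "'a operator \<Rightarrow> 'a operator"
  where "abs_operator x = fun_calc sqrt (adj x o\<^sub>L x)"

text \<open>Only used for positive operators, whose diagonal entries are nonnegative reals.\<close>

definition op_trace :: "'a operator \<Rightarrow> ennreal"
  where "op_trace T = (\<Sum>\<^sub>\<infinity>i. ennreal (Re (cinner (ket i) (blinfun_apply T (ket i)))))"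

section \<open>Schatten classes\<close>

definition trace_abs_powr :: "real \<Rightarrow> 'a operator \<Rightarrow> ennreal"
  where "trace_abs_powr p x = op_trace (fun_calc (\<lambda>t. t powr p) (abs_operator x))"

definition schatten_class :: "real \<Rightarrow> 'a operator set"
  where "schatten_class p = {x \<in> bounded_operators. trace_abs_powr p x < \<infinity>}"

definition schatten_norm :: "real \<Rightarrow> 'a operator \<Rightarrow> real"
  where "schatten_norm p x = enn2real (trace_abs_powr p x) powr (1 / p)"

section \<open>Schur multipliers\<close>

definition schur_multiplier :: "('a \<Rightarrow> 'a \<Rightarrow> complex) \<Rightarrow> 'a operator \<Rightarrow> 'a operator"
  where "schur_multiplier a x =
    (THE y. y \<in> bounded_operators \<and> (\<forall>i j. matrix_of y i j = a i j * matrix_of x i j))"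

definition schur_maps :: "real \<Rightarrow> real \<Rightarrow> ('a \<Rightarrow> 'a \<Rightarrow> complex) \<Rightarrow> bool"
  where "schur_maps p q a \<longleftrightarrow>
    (\<forall>x\<in>schatten_class p. \<exists>y\<in>schatten_class q. \<forall>i j. matrix_of y i j = a i j * matrix_of x i j)"

text \<open>The norm of \<open>A : S\<^sub>p(\<ell>\<^sub>2(X)) \<rightarrow> S\<^sub>q(\<ell>\<^sub>2(X))\<close>, with value \<open>\<infinity>\<close> if \<open>A\<close> is not everywhere defined.\<close>

definition schur_norm :: "real \<Rightarrow> real \<Rightarrow> ('a \<Rightarrow> 'a \<Rightarrow> complex) \<Rightarrow> ennreal"
  where "schur_norm p q a =
    (if schur_maps p q a
     then (SUP x\<in>{x \<in> schatten_class p. schatten_norm p x \<le> 1}.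
             ennreal (schatten_norm q (schur_multiplier a x)))
     else \<infinity>)"

section \<open>The weak norm \<open>\<parallel>a\<parallel>\<close> in \<open>\<ell>\<^sub>r\<^sub>,\<^sub>\<infinity>(X \<times> X)\<close>\<close>

definition decr_rearr :: "('a \<Rightarrow> 'a \<Rightarrow> complex) \<Rightarrow> real \<Rightarrow> ennreal"
  where "decr_rearr a t =
    Inf (ennreal ` {s. 0 < s \<and> emeasure (count_space UNIV) {(i, j). s < cmod (a i j)} < ennreal t})"

definition weak_norm :: "ereal \<Rightarrow> ('a \<Rightarrow> 'a \<Rightarrow> complex) \<Rightarrow> ennreal"
  where "weak_norm r a =
    (if r = \<infinity> then (SUP (i, j). ennreal (cmod (a i j)))
     else (SUP t\<in>{0<..}. ennreal (t powr (1 / real_of_ereal r)) * decr_rearr a t))"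

end

theory Submission
  imports Defs
begin

text \<open>
  Three facts give the inequality with constant 1.

  \<^item> For counting measure the weak norm dominates the supremum of the entries: \<open>\<mu>\<^sub>1(a)\<close> is that supremum,
    since a set with fewer than one element is empty (\<open>cmod_le_weak_norm\<close>).

  \<^item> For \<open>p \<le> 2 \<le> q\<close> the inclusions of \<open>S\<^sub>p\<close> in \<open>S\<^sub>2\<close> and of \<open>S\<^sub>2\<close> in \<open>S\<^sub>q\<close> are contractions
    (\<open>hs_le_one\<close>, \<open>schatten_norm_le_hs\<close>).

  \<^item> The norm of \<open>S\<^sub>2\<close> is the \<open>\<ell>\<^sub>2\<close> norm of the matrix, so on \<open>S\<^sub>2\<close> a Schur multiplier has norm at most the
    supremum of its entries (\<open>schur_multiplier_hs\<close>).

  So the Schur multiplier factors as \<open>S\<^sub>p \<rightarrow> S\<^sub>2 \<rightarrow> S\<^sub>2 \<rightarrow> S\<^sub>q\<close> with norm at most \<open>sup |a\<^sub>i\<^sub>j|\<close>, which is at most the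
  weak norm of \<open>a\<close> (\<open>schur_norm_le_weak_norm\<close>). The constant 1 is optimal already for the symbol with a
  single entry 1, whose weak norm is 1 and which fixes a projection of rank one
  (\<open>schur_norm_matrix_unit\<close>). A constant that is valid for \<open>X = nat\<close> is therefore at least 1, hence valid
  for every \<open>X\<close>.

  The inclusions of Schatten classes come from comparisons of functions under the continuous functional
  calculus. With \<open>M = \<parallel>x\<parallel>\<close> one has \<open>t\<^sup>2 \<le> M\<^sup>2\<^sup>-\<^sup>p t\<^sup>p\<close> and \<open>t\<^sup>q \<le> M\<^sup>q\<^sup>-\<^sup>2 t\<^sup>2\<close> on \<open>[0, M]\<close>, so the traces of the
  corresponding powers of \<open>|x|\<close> compare in the same way, and \<open>M\<close> is at most the Hilbert-Schmidt norm.
  The calculus enters through its multiplicativity and its monotonicity. The latter rests on one fact about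
  polynomials: if \<open>P \<ge> 0\<close> on \<open>[0, \<parallel>T\<parallel>]\<close> for a positive operator \<open>T\<close>, then \<open>P(T)\<close> is positive
  (\<open>poly_operator_nonneg\<close>). It is proved by induction on the degree of \<open>P\<close>, splitting off a factor at a
  minimum of \<open>P\<close>.
\<close>

section \<open>The geometry of square-summable families\<close>

lemma coord_eqI: "(\<And>i. coord x i = coord y i) \<Longrightarrow> x = y"
  by (simp add: coord_inject[symmetric] fun_eq_iff)

lemma coord_summable: "(\<lambda>i. (cmod (coord x i))\<^sup>2) summable_on UNIV"
  using coord[of x] by simp

lemma cinner_has_sum: "((\<lambda>i. cnj (coord x i) * coord y i) has_sum cinner x y) UNIV"
  unfolding cinner.rep_eq by (rule has_sum_infsum[OF cinner_summable])

lemma cinner_self_has_sum: "((\<lambda>i. (cmod (coord x i))\<^sup>2) has_sum (norm x)\<^sup>2) UNIV"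
proof -
  have "((\<lambda>i. Re (cnj (coord x i) * coord x i)) has_sum Re (cinner x x)) UNIV"
    by (rule has_sum_Re[OF cinner_has_sum])
  moreover have "Re (cnj z * z) = (cmod z)\<^sup>2" for z
    by (simp add: cmod_power2) (simp add: power2_eq_square)
  moreover have "Re (cinner x x) = (norm x)\<^sup>2"
    using power2_norm_eq_inner[of x] by (simp add: inner_ell2_def)
  ultimately show ?thesis by simp
qed

lemma infsum_ennreal:
  fixes f :: "'i \<Rightarrow> real"
  assumes "(f has_sum S) UNIV" and nn: "\<And>i. 0 \<le> f i"
  shows "(\<Sum>\<^sub>\<infinity>i. ennreal (f i)) = ennreal S"
proof -
  have "ennreal S = (SUP F\<in>{F. finite F \<and> F \<subseteq> UNIV}. ennreal (sum f F))"
    using infsum_nonneg_is_SUPREMUM_ennreal[of f UNIV] assms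
    by (auto simp: has_sum_iff)
  also have "\<dots> = (\<Sum>\<^sub>\<infinity>i. ennreal (f i))"
    by (subst nonneg_infsum_complete) (auto simp: nn intro!: SUP_cong)
  finally show ?thesis by simp
qed

lemma ennreal_norm_sq: "(\<Sum>\<^sub>\<infinity>i. ennreal ((cmod (coord x i))\<^sup>2)) = ennreal ((norm x)\<^sup>2)"
  by (rule infsum_ennreal[OF cinner_self_has_sum]) simp

lemma cinner_commute: "cinner x y = cnj (cinner y x)"
  by (simp add: cinner.rep_eq flip: infsum_cnj) (simp add: mult.commute)

lemma cinner_add_right: "cinner x (y + z) = cinner x y + cinner x z"
  unfolding cinner.rep_eq plus_ell2.rep_eq
  by (simp add: distrib_left infsum_add cinner_summable)

lemma cinner_scaleC_right: "cinner x (scaleC c y) = c * cinner x y"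
  unfolding cinner.rep_eq scaleC.rep_eq
  by (simp add: mult.left_commute infsum_cmult_right')

lemma cinner_scaleC_left: "cinner (scaleC c x) y = cnj c * cinner x y"
  by (subst cinner_commute) (simp add: cinner_scaleC_right flip: cinner_commute[of x])

lemma scaleC_of_real: "scaleC (of_real c) x = c *\<^sub>R x"
  by (rule coord_eqI) (simp add: scaleC.rep_eq scaleR_ell2.rep_eq)

lemma norm_scaleC: "norm (scaleC c x) = cmod c * norm x"
proof -
  have "((\<lambda>i. (cmod (coord (scaleC c x) i))\<^sup>2) has_sum (cmod c)\<^sup>2 * (norm x)\<^sup>2) UNIV"
    unfolding scaleC.rep_eq norm_mult power_mult_distrib
    by (rule has_sum_cmult_right[OF cinner_self_has_sum])
  then have "(norm (scaleC c x))\<^sup>2 = (cmod c * norm x)\<^sup>2"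
    using has_sum_unique[OF cinner_self_has_sum] by (simp add: power_mult_distrib)
  then show ?thesis
    by (rule power2_eq_imp_eq) auto
qed

lemma cinner_cauchy_schwarz: "cmod (cinner x y) \<le> norm x * norm y"
proof (cases "cinner x y = 0")
  case False
  define c where "c = cinner x y / of_real (cmod (cinner x y))"
  have c: "cmod c = 1"
    using False by (simp add: c_def norm_divide)
  have "inner (scaleC c x) y = Re (cnj (cinner x y) * cinner x y / of_real (cmod (cinner x y)))"
    by (simp add: inner_ell2_def cinner_scaleC_left c_def)
  also have "cnj (cinner x y) * cinner x y / of_real (cmod (cinner x y)) = of_real (cmod (cinner x y))"
    using False by (simp add: mult.commute[of "cnj _"] complex_norm_square[symmetric] power2_eq_square)
  finally have "inner (scaleC c x) y = cmod (cinner x y)" by simp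
  then show ?thesis
    using norm_cauchy_schwarz[of "scaleC c x" y] by (simp add: norm_scaleC c)
qed simp

lemma coord_ket: "coord (ket i) j = (if j = i then 1 else 0)"
  by (simp add: ket.rep_eq)

lemma cinner_ket_left: "cinner (ket i) x = coord x i"
proof -
  have "cinner (ket i) x = (\<Sum>\<^sub>\<infinity>j\<in>{i}. coord x j)"
    unfolding cinner.rep_eq coord_ket by (rule infsum_cong_neutral) auto
  then show ?thesis by simp
qed

lemma norm_ket: "norm (ket i) = 1"
proof -
  have "(norm (ket i))\<^sup>2 = 1"
    by (simp add: power2_norm_eq_inner inner_ell2_def cinner_ket_left coord_ket)
  then show ?thesis by (simp add: power2_eq_1_iff)
    (metis norm_ge_zero add.inverse_inverse le_minus_one_simps(3))
qed

lemma cmod_coord_le: "cmod (coord x i) \<le> norm x"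
  using cinner_cauchy_schwarz[of "ket i" x] by (simp add: cinner_ket_left norm_ket)

lemma bounded_linear_cinner_right: "bounded_linear (cinner x)"
proof (rule bounded_linear_intro)
  show "cinner x (r *\<^sub>R y) = r *\<^sub>R cinner x y" for r y
    using cinner_scaleC_right[of x "of_real r" y] by (simp add: scaleC_of_real scaleR_conv_of_real)
  show "norm (cinner x y) \<le> norm y * norm x" for y
    using cinner_cauchy_schwarz[of x y] by (simp add: mult.commute)
qed (rule cinner_add_right)

lemma coord_sum: "coord (\<Sum>i\<in>F. f i) j = (\<Sum>i\<in>F. coord (f i) j)"
  by (induction F rule: infinite_finite_induct) (auto simp: plus_ell2.rep_eq zero_ell2.rep_eq)

lemma norm_sq_sum_ket:
  assumes "finite F"
  shows "(norm (\<Sum>i\<in>F. scaleC (c i) (ket i)))\<^sup>2 = (\<Sum>i\<in>F. (cmod (c i))\<^sup>2)"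
proof -
  have coord: "coord (\<Sum>i\<in>F. scaleC (c i) (ket i)) j = (if j \<in> F then c j else 0)" for j
    using assms by (simp add: coord_sum scaleC.rep_eq coord_ket if_distrib cong: if_cong)
  have "((\<lambda>j. (cmod (c j))\<^sup>2) has_sum (\<Sum>i\<in>F. (cmod (c i))\<^sup>2)) F"
    using assms by (rule has_sum_finite)
  then have "((\<lambda>j. (cmod (if j \<in> F then c j else 0))\<^sup>2) has_sum (\<Sum>i\<in>F. (cmod (c i))\<^sup>2)) UNIV"
    by (subst has_sum_cong_neutral[where T = F]) auto
  then show ?thesis
    unfolding coord[symmetric] by (rule has_sum_unique[OF cinner_self_has_sum])
qed

text \<open>A partial sum over \<open>F\<close> leaves a remainder whose squared norm is the part of \<open>\<Sum>|v\<^sub>i|\<^sup>2\<close> outside \<open>F\<close>, which tends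
to 0. The expansion reduces identities between bounded complex-linear operators to identities between their
matrices.\<close>

lemma ket_expansion: "((\<lambda>i. scaleC (coord v i) (ket i)) has_sum v) UNIV"
proof -
  define s where "s F = (\<Sum>i\<in>F. scaleC (coord v i) (ket i))" for F
  define h where "h F = (\<Sum>i\<in>F. (cmod (coord v i))\<^sup>2)" for F
  have rest: "(norm (v - s F))\<^sup>2 = (norm v)\<^sup>2 - h F" if "finite F" for F
  proof -
    have "coord (s F) j = (if j \<in> F then coord v j else 0)" for j
      using that by (simp add: s_def coord_sum scaleC.rep_eq coord_ket if_distrib cong: if_cong)
    then have *: "coord (v - s F) j = (if j \<in> F then 0 else coord v j)" for j
      by (simp add: minus_ell2.rep_eq)
    have "((\<lambda>j. (cmod (coord v j))\<^sup>2) has_sum ((norm v)\<^sup>2 - h F)) (UNIV - F)"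
      by (rule has_sum_Diff[OF cinner_self_has_sum]) (auto simp: h_def that)
    then have "((\<lambda>j. (cmod (coord (v - s F) j))\<^sup>2) has_sum ((norm v)\<^sup>2 - h F)) UNIV"
      unfolding * by (subst has_sum_cong_neutral[where T = "UNIV - F"]) auto
    then show ?thesis
      using has_sum_unique[OF cinner_self_has_sum] by blast
  qed
  have "((\<lambda>F. (norm v)\<^sup>2 - h F) \<longlongrightarrow> (norm v)\<^sup>2 - (norm v)\<^sup>2) (finite_subsets_at_top UNIV)"
    unfolding h_def by (intro tendsto_diff tendsto_const
      cinner_self_has_sum[unfolded has_sum_def])
  then have "((\<lambda>F. sqrt ((norm v)\<^sup>2 - h F)) \<longlongrightarrow> sqrt 0) (finite_subsets_at_top UNIV)"
    by (intro tendsto_real_sqrt) simp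
  moreover have "\<forall>\<^sub>F F in finite_subsets_at_top UNIV. sqrt ((norm v)\<^sup>2 - h F) = norm (v - s F)"
    by (rule eventually_finite_subsets_at_top_weakI) (simp add: rest[symmetric])
  ultimately have "((\<lambda>F. norm (v - s F)) \<longlongrightarrow> sqrt 0) (finite_subsets_at_top UNIV)"
    by (rule Lim_transform_eventually)
  then have "((\<lambda>F. norm (s F - v)) \<longlongrightarrow> 0) (finite_subsets_at_top UNIV)"
    by (simp add: norm_minus_commute)
  from LIM_zero_cancel[OF tendsto_norm_zero_cancel[OF this]] show ?thesis
    unfolding has_sum_def s_def .
qed

text \<open>Completeness makes the operators on \<open>\<ell>\<^sub>2(X)\<close> a Banach space, as the limits that define the functional
calculus require. A Cauchy sequence converges in every coordinate, and the bound on its tails passes to the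
limit on finite sets of coordinates, hence to the whole sum.\<close>

instance ell2 :: (type) banach
proof
  fix X :: "nat \<Rightarrow> 'a ell2"
  assume X: "Cauchy X"
  have "Cauchy (\<lambda>n. coord (X n) i)" for i
  proof (rule metric_CauchyI)
    fix e :: real assume "0 < e"
    then obtain N where N: "\<And>m n. N \<le> m \<Longrightarrow> N \<le> n \<Longrightarrow> dist (X m) (X n) < e"
      using metric_CauchyD[OF X] by meson
    have "dist (coord (X m) i) (coord (X n) i) < e" if "N \<le> m" "N \<le> n" for m n
      using cmod_coord_le[of "X m - X n" i] N[OF that] by (simp add: dist_norm minus_ell2.rep_eq)
    then show "\<exists>N. \<forall>m\<ge>N. \<forall>n\<ge>N. dist (coord (X m) i) (coord (X n) i) < e" by blast
  qed
  then have "\<exists>l. (\<lambda>n. coord (X n) i) \<longlonglongrightarrow> l" for i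
    using Cauchy_convergent convergent_def by blast
  then obtain f where f: "\<And>i. (\<lambda>n. coord (X n) i) \<longlonglongrightarrow> f i" by metis
  have tail: "(\<Sum>i\<in>F. (cmod (f i - coord (X n) i))\<^sup>2) \<le> e\<^sup>2"
    if "finite F" "N \<le> n" and N: "\<And>m n. N \<le> m \<Longrightarrow> N \<le> n \<Longrightarrow> dist (X m) (X n) < e" for F e n N
  proof (rule tendsto_upperbound)
    show "(\<lambda>m. \<Sum>i\<in>F. (cmod (coord (X m) i - coord (X n) i))\<^sup>2)
        \<longlonglongrightarrow> (\<Sum>i\<in>F. (cmod (f i - coord (X n) i))\<^sup>2)"
      by (intro tendsto_intros f)
    have "(\<Sum>i\<in>F. (cmod (coord (X m) i - coord (X n) i))\<^sup>2) \<le> e\<^sup>2" if "N \<le> m" for m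
    proof -
      have "(\<Sum>i\<in>F. (cmod (coord (X m - X n) i))\<^sup>2) \<le> (norm (X m - X n))\<^sup>2"
        by (rule finite_sum_le_has_sum[OF cinner_self_has_sum]) (use \<open>finite F\<close> in auto)
      also have "\<dots> \<le> e\<^sup>2"
        using N[OF \<open>N \<le> m\<close> \<open>N \<le> n\<close>] by (intro power_mono) (auto simp: dist_norm)
      finally show ?thesis by (simp add: minus_ell2.rep_eq)
    qed
    then show "\<forall>\<^sub>F m in sequentially. (\<Sum>i\<in>F. (cmod (coord (X m) i - coord (X n) i))\<^sup>2) \<le> e\<^sup>2"
      by (auto simp: eventually_sequentially)
  qed simp
  have sq_summable: "(\<lambda>i. (cmod (f i - coord (X n) i))\<^sup>2) summable_on UNIV"
    if "N \<le> n" and N: "\<And>m n. N \<le> m \<Longrightarrow> N \<le> n \<Longrightarrow> dist (X m) (X n) < e" for e n N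
    by (rule nonneg_bdd_above_summable_on) (use tail[OF _ that] in \<open>auto simp: bdd_above_def\<close>)
  obtain N1 where N1: "\<And>m n. N1 \<le> m \<Longrightarrow> N1 \<le> n \<Longrightarrow> dist (X m) (X n) < 1"
    using metric_CauchyD[OF X, of 1] by (meson zero_less_one)
  \<comment> \<open>The limit is square-summable because it differs from a member of the sequence by a square-summable family.\<close>
  have "(\<lambda>i. (cmod ((f i - coord (X N1) i) + coord (X N1) i))\<^sup>2) summable_on UNIV"
    by (intro ell2_summable_add sq_summable[OF order_refl N1] coord_summable)
  then obtain L where L: "coord L = f"
    by (metis (no_types, lifting) Abs_ell2_inverse diff_add_cancel ext mem_Collect_eq)
  have "X \<longlonglongrightarrow> L"
  proof (rule metric_LIMSEQ_I)
    fix e :: real assume e: "0 < e"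
    then obtain N where N: "\<And>m n. N \<le> m \<Longrightarrow> N \<le> n \<Longrightarrow> dist (X m) (X n) < e / 2"
      using metric_CauchyD[OF X, of "e/2"] by (meson half_gt_zero)
    have "dist (X n) L < e" if "N \<le> n" for n
    proof -
      have "(norm (L - X n))\<^sup>2 \<le> (e / 2)\<^sup>2"
        by (rule has_sum_le_finite_sums[OF cinner_self_has_sum])
          (simp add: minus_ell2.rep_eq L tail[OF _ that N])
      then have "norm (L - X n) \<le> e / 2"
        by (rule power2_le_imp_le) (use e in simp)
      then show ?thesis using e by (simp add: dist_norm norm_minus_commute)
    qed
    then show "\<exists>N. \<forall>n\<ge>N. dist (X n) L < e" by blast
  qed
  then show "convergent X" by (auto simp: convergent_def)
qed

section \<open>Operators, their matrices and their adjoints\<close>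

lemma bounded_operators_scaleC:
  "x \<in> bounded_operators \<Longrightarrow> blinfun_apply x (scaleC c u) = scaleC c (blinfun_apply x u)"
  by (simp add: bounded_operators_def)

lemma operator_ket_expansion:
  assumes "x \<in> bounded_operators"
  shows "((\<lambda>j. scaleC (coord v j) (blinfun_apply x (ket j))) has_sum blinfun_apply x v) UNIV"
  using has_sum_bounded_linear[OF blinfun.bounded_linear_right[of x] ket_expansion[of v]]
  by (simp add: bounded_operators_scaleC[OF assms])

lemma matrix_of_inject:
  assumes "x \<in> bounded_operators" "y \<in> bounded_operators"
    and "\<And>i j. matrix_of x i j = matrix_of y i j"
  shows "x = y"
proof (rule blinfun_eqI)
  fix v
  have "blinfun_apply x (ket j) = blinfun_apply y (ket j)" for j
    by (rule coord_eqI) (use assms(3) in \<open>simp add: matrix_of_def\<close>)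
  then show "blinfun_apply x v = blinfun_apply y v"
    using has_sum_unique[OF operator_ket_expansion[OF assms(1), of v]]
      operator_ket_expansion[OF assms(2), of v] by simp
qed

text \<open>Adjoints, Hilbert-Schmidt matrices and projections onto basis vectors are obtained from this construction.
The rows of the resulting matrix are the conjugates of the \<open>R i\<close>, because \<open>cinner\<close> is conjugate-linear in its
first argument.\<close>

lemma operator_of_rows:
  fixes R :: "'a \<Rightarrow> 'a ell2"
  assumes K: "\<And>F u. finite F \<Longrightarrow> (\<Sum>i\<in>F. (cmod (cinner (R i) u))\<^sup>2) \<le> K\<^sup>2 * (norm u)\<^sup>2" and "0 \<le> K"
  obtains y where "y \<in> bounded_operators" "\<And>u i. coord (blinfun_apply y u) i = cinner (R i) u"
proof -
  define Y where "Y u = Abs_ell2 (\<lambda>i. cinner (R i) u)" for u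
  have Y: "coord (Y u) i = cinner (R i) u" for u i
  proof -
    have "(\<lambda>i. (cmod (cinner (R i) u))\<^sup>2) summable_on UNIV"
      by (rule nonneg_bdd_above_summable_on) (use K in \<open>auto simp: bdd_above_def\<close>)
    then show ?thesis by (simp add: Y_def Abs_ell2_inverse)
  qed
  have "bounded_linear Y"
  proof (rule bounded_linear_intro)
    show "Y (u + v) = Y u + Y v" for u v
      by (rule coord_eqI) (simp add: Y plus_ell2.rep_eq cinner_add_right)
    show "Y (c *\<^sub>R u) = c *\<^sub>R Y u" for c u
      by (rule coord_eqI)
        (simp add: Y scaleC_of_real[symmetric] scaleC.rep_eq cinner_scaleC_right)
    show "norm (Y u) \<le> norm u * K" for u
    proof -
      have "(norm (Y u))\<^sup>2 \<le> K\<^sup>2 * (norm u)\<^sup>2"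
        by (rule has_sum_le_finite_sums[OF cinner_self_has_sum]) (simp add: Y K)
      then have "(norm (Y u))\<^sup>2 \<le> (norm u * K)\<^sup>2"
        by (simp add: power_mult_distrib mult.commute)
      then show ?thesis
        by (rule power2_le_imp_le) (use \<open>0 \<le> K\<close> in simp)
    qed
  qed
  then have app: "blinfun_apply (Blinfun Y) = Y" by (rule bounded_linear_Blinfun_apply)
  have "Blinfun Y \<in> bounded_operators"
    unfolding bounded_operators_def
    by (auto simp: app intro!: coord_eqI simp: Y scaleC.rep_eq cinner_scaleC_right)
  with that[of "Blinfun Y"] show thesis by (simp add: app Y)
qed

text \<open>The coordinates of \<open>x\<^sup>*u\<close> have to be \<open>cinner (x e\<^sub>i) u\<close>. They are square-summable: testing \<open>x\<close> on the vector \<open>v\<close>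
formed from finitely many of them gives \<open>\<parallel>v\<parallel>\<^sup>2 \<le> \<parallel>u\<parallel> \<parallel>x\<parallel> \<parallel>v\<parallel>\<close>.\<close>

lemma adj_exists:
  fixes x :: "'a operator"
  assumes x: "x \<in> bounded_operators"
  obtains y where "y \<in> bounded_operators" 
    "\<And>u v. cinner (blinfun_apply y u) v = cinner u (blinfun_apply x v)"
proof -
  have "(\<Sum>i\<in>F. (cmod (cinner (blinfun_apply x (ket i)) u))\<^sup>2) \<le> (norm x)\<^sup>2 * (norm u)\<^sup>2"
    if "finite F" for F u
  proof -
    define c where "c i = cinner (blinfun_apply x (ket i)) u" for i
    define v where "v = (\<Sum>i\<in>F. scaleC (c i) (ket i))"
    define s where "s = (\<Sum>i\<in>F. (cmod (c i))\<^sup>2)"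
    have s0: "0 \<le> s" by (simp add: s_def sum_nonneg)
    have v: "(norm v)\<^sup>2 = s" by (simp add: v_def s_def norm_sq_sum_ket that)
    have "cinner u (blinfun_apply x v) = (\<Sum>i\<in>F. c i * cinner u (blinfun_apply x (ket i)))"
      by (simp add: v_def blinfun.sum_right bounded_operators_scaleC[OF x]
          linear_sum[OF bounded_linear.linear[OF bounded_linear_cinner_right]] cinner_scaleC_right)
    also have "\<dots> = (\<Sum>i\<in>F. c i * cnj (c i))"
      by (simp add: c_def flip: cinner_commute[of u])
    also have "\<dots> = of_real s"
      by (simp add: s_def complex_norm_square[symmetric])
    finally have "cmod (of_real s) \<le> norm u * norm (blinfun_apply x v)"
      by (metis cinner_cauchy_schwarz)
    also have "\<dots> \<le> norm u * (norm x * norm v)"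
      by (intro mult_left_mono norm_blinfun) simp
    finally have "norm v * norm v \<le> norm u * norm x * norm v"
      using s0 v by (simp add: power2_eq_square mult.assoc)
    then have "norm v \<le> norm u * norm x"
      by (cases "norm v = 0") (auto simp: mult_le_cancel_right)
    then have "(norm v)\<^sup>2 \<le> (norm u * norm x)\<^sup>2"
      by (intro power_mono) auto
    then show ?thesis
      by (simp add: v[symmetric, unfolded s_def c_def] power_mult_distrib mult.commute)
  qed
  then obtain y where y: "y \<in> bounded_operators"
      "\<And>u i. coord (blinfun_apply y u) i = cinner (blinfun_apply x (ket i)) u"
    using operator_of_rows[of "\<lambda>i. blinfun_apply x (ket i)" "norm x"] by auto
  have "cinner (blinfun_apply y u) v = cinner u (blinfun_apply x v)" for u v
  proof -
    have "((\<lambda>i. coord v i * cinner u (blinfun_apply x (ket i))) has_sum cinner u (blinfun_apply x v)) UNIV"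
      using has_sum_bounded_linear[OF bounded_linear_cinner_right operator_ket_expansion[OF x]]
      by (simp add: cinner_scaleC_right)
    moreover have "(\<lambda>i. cnj (coord (blinfun_apply y u) i) * coord v i)
        = (\<lambda>i. coord v i * cinner u (blinfun_apply x (ket i)))"
      by (simp add: y mult.commute flip: cinner_commute[of u])
    ultimately have "((\<lambda>i. cnj (coord (blinfun_apply y u) i) * coord v i)
        has_sum cinner u (blinfun_apply x v)) UNIV"
      by simp
    then show ?thesis
      by (rule has_sum_unique[OF cinner_has_sum])
  qed
  with y(1) that show thesis by blast
qed

lemma adj_eqI:
  assumes y: "\<And>u v. cinner (blinfun_apply y u) v = cinner u (blinfun_apply x v)"
  shows "adj x = y"
  unfolding adj_def
proof (rule the_equality)
  fix z assume z: "\<forall>u v. cinner (blinfun_apply z u) v = cinner u (blinfun_apply x v)"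
  show "z = y"
  proof (intro blinfun_eqI coord_eqI)
    fix u i
    have "cnj (cinner (blinfun_apply z u) (ket i)) = cnj (cinner (blinfun_apply y u) (ket i))"
      by (simp add: y z)
    then show "coord (blinfun_apply z u) i = coord (blinfun_apply y u) i"
      by (simp add: cinner_ket_left flip: cinner_commute)
  qed
qed (simp add: y)

lemma cinner_adj_left:
  assumes "x \<in> bounded_operators"
  shows "cinner (blinfun_apply (adj x) u) v = cinner u (blinfun_apply x v)"
proof -
  obtain y where y: "\<And>u v. cinner (blinfun_apply y u) v = cinner u (blinfun_apply x v)"
    using adj_exists[OF assms] by metis
  show ?thesis by (simp add: adj_eqI[OF y] y)
qed

section \<open>Polynomials of an operator\<close>

abbreviation op_power :: "'a operator \<Rightarrow> nat \<Rightarrow> 'a operator"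
  where "op_power T k \<equiv> (((o\<^sub>L) T) ^^ k) id_blinfun"

lemma poly_operator_bound:
  assumes "degree P \<le> n"
  shows "poly_operator P T = (\<Sum>k\<le>n. coeff P k *\<^sub>R op_power T k)"
  unfolding poly_operator_def
  by (rule sum.mono_neutral_left) (use assms in \<open>auto simp: coeff_eq_0\<close>)

lemma poly_operator_0 [simp]: "poly_operator 0 T = 0"
  by (simp add: poly_operator_def)

lemma poly_operator_pCons:
  "poly_operator (pCons c P) T = c *\<^sub>R id_blinfun + (T o\<^sub>L poly_operator P T)"
proof -
  have "poly_operator (pCons c P) T = (\<Sum>k\<le>Suc (degree P). coeff (pCons c P) k *\<^sub>R op_power T k)"
    by (rule poly_operator_bound) (rule degree_pCons_le)
  also have "\<dots> = c *\<^sub>R id_blinfun + (\<Sum>k\<le>degree P. coeff P k *\<^sub>R (T o\<^sub>L op_power T k))"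
    by (subst sum.atMost_Suc_shift) simp
  also have "(\<Sum>k\<le>degree P. coeff P k *\<^sub>R (T o\<^sub>L op_power T k)) = T o\<^sub>L poly_operator P T"
    by (simp add: poly_operator_def bounded_bilinear.sum_right[OF bounded_bilinear_blinfun_compose]
        bounded_bilinear.scaleR_right[OF bounded_bilinear_blinfun_compose])
  finally show ?thesis .
qed

lemma poly_operator_const: "poly_operator [:c:] T = c *\<^sub>R id_blinfun"
  by (simp add: poly_operator_pCons)

lemma poly_operator_X: "poly_operator [:0, 1:] T = T"
  by (rule blinfun_eqI) (simp add: poly_operator_pCons)

lemma poly_operator_add: "poly_operator (P + Q) T = poly_operator P T + poly_operator Q T"
  by (induction P Q rule: poly_induct2)
    (simp_all add: poly_operator_pCons scaleR_add_left
      bounded_bilinear.add_right[OF bounded_bilinear_blinfun_compose])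

lemma poly_operator_smult: "poly_operator (smult c P) T = c *\<^sub>R poly_operator P T"
  by (induction P)
    (simp_all add: poly_operator_pCons scaleR_add_right
      bounded_bilinear.scaleR_right[OF bounded_bilinear_blinfun_compose])

lemma poly_operator_diff: "poly_operator (P - Q) T = poly_operator P T - poly_operator Q T"
  using poly_operator_add[of P "- Q" T] poly_operator_smult[of "- 1" Q T] by simp

lemma poly_operator_mult: "poly_operator (P * Q) T = poly_operator P T o\<^sub>L poly_operator Q T"
proof (induction P)
  case (pCons c P)
  then show ?case
    by (intro blinfun_eqI)
      (simp add: poly_operator_add poly_operator_smult poly_operator_pCons blinfun.add_left
        blinfun.scaleR_left)
qed simp

definition positive_operator :: "'a operator \<Rightarrow> bool"
  where "positive_operator T \<longleftrightarrow> (\<forall>u v. inner (blinfun_apply T u) v = inner u (blinfun_apply T v)) \<and>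
    (\<forall>u. 0 \<le> inner u (blinfun_apply T u))"

lemma positive_operator_sym: "positive_operator T \<Longrightarrow> inner (blinfun_apply T u) v = inner u (blinfun_apply T v)"
  by (simp add: positive_operator_def)

text \<open>For the leading factor \<open>T\<close> in \<open>T P(T)\<close> to move to the other side and back, \<open>T\<close> has to commute with \<open>P(T)\<close>;
this is commutativity of polynomial multiplication.\<close>

lemma poly_operator_sym:
  assumes T: "positive_operator T"
  shows "inner (blinfun_apply (poly_operator P T) u) v = inner u (blinfun_apply (poly_operator P T) v)"
proof (induction P arbitrary: u v)
  case (pCons c P)
  have "T o\<^sub>L poly_operator P T = poly_operator P T o\<^sub>L T"
    by (metis mult.commute poly_operator_X poly_operator_mult)
  then have "blinfun_apply T (blinfun_apply (poly_operator P T) v)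
      = blinfun_apply (poly_operator P T) (blinfun_apply T v)" for v
    by (metis blinfun_apply_blinfun_compose)
  then show ?case
    by (simp add: poly_operator_pCons blinfun.add_left blinfun.scaleR_left inner_add_left
        inner_add_right positive_operator_sym[OF T] pCons.IH)
qed simp

section \<open>Positivity of polynomials of a positive operator\<close>

text \<open>Used after a root \<open>t\<close> has been divided out: the sign of the quotient is known away from \<open>t\<close> only.\<close>

lemma poly_nonneg_puncture:
  fixes P :: "real poly"
  assumes "a < b" "t \<in> {a..b}" and nn: "\<And>s. s \<in> {a..b} \<Longrightarrow> s \<noteq> t \<Longrightarrow> 0 \<le> poly P s"
  shows "0 \<le> poly P t"
proof (rule tendsto_lowerbound)
  show "(poly P \<longlongrightarrow> poly P t) (at t within {a..b})"
    by (intro tendsto_poly tendsto_ident_at)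
  show "\<forall>\<^sub>F s in at t within {a..b}. 0 \<le> poly P s"
    by (auto simp: eventually_at_filter nn)
  show "at t within {a..b} \<noteq> bot"
    using assms(1,2) connected_imp_perfect[of "{a..b}" t]
    by (auto simp: trivial_limit_within)
qed

definition form_nonneg :: "'a operator \<Rightarrow> real poly \<Rightarrow> bool"
  where "form_nonneg T P \<longleftrightarrow> (\<forall>u. 0 \<le> inner u (blinfun_apply (poly_operator P T) u))"

lemma form_nonneg_add: "form_nonneg T P \<Longrightarrow> form_nonneg T Q \<Longrightarrow> form_nonneg T (P + Q)"
  by (simp add: form_nonneg_def poly_operator_add blinfun.add_left inner_add_right)

lemma form_nonneg_smult: "form_nonneg T P \<Longrightarrow> 0 \<le> c \<Longrightarrow> form_nonneg T (smult c P)"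
  by (simp add: form_nonneg_def poly_operator_smult blinfun.scaleR_left)

lemma form_nonneg_conj:
  assumes "positive_operator T" "form_nonneg T P"
  shows "form_nonneg T (Q * (P * Q))"
  unfolding form_nonneg_def
proof
  fix u
  have "inner u (blinfun_apply (poly_operator (Q * (P * Q)) T) u)
      = inner (blinfun_apply (poly_operator Q T) u)
          (blinfun_apply (poly_operator P T) (blinfun_apply (poly_operator Q T) u))"
    by (simp only: poly_operator_mult blinfun_apply_blinfun_compose poly_operator_sym[OF assms(1), of Q])
  then show "0 \<le> inner u (blinfun_apply (poly_operator (Q * (P * Q)) T) u)"
    using assms(2) by (simp only: form_nonneg_def)
qed

lemma form_nonneg_const: "0 \<le> c \<Longrightarrow> form_nonneg T [:c:]"
  by (simp add: form_nonneg_def poly_operator_const blinfun.scaleR_left)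

lemma form_nonneg_upper:
  "form_nonneg T [:norm T, -1:]"
proof -
  have "inner u (blinfun_apply T u) \<le> norm T * inner u u" for u
  proof -
    have "inner u (blinfun_apply T u) \<le> norm u * norm (blinfun_apply T u)"
      by (rule norm_cauchy_schwarz)
    also have "\<dots> \<le> norm u * (norm T * norm u)"
      by (intro mult_left_mono norm_blinfun) simp
    finally show ?thesis by (simp add: dot_square_norm power2_eq_square mult.left_commute)
  qed
  then show ?thesis
    by (simp add: form_nonneg_def poly_operator_pCons blinfun.add_left
        blinfun.scaleR_left blinfun.minus_left blinfun.minus_right inner_add_right inner_diff_right)
qed

text \<open>Nonnegativity of \<open>P(T)\<close> alone is not visibly preserved when \<open>P\<close> is multiplied by \<open>t\<close> or by \<open>\<parallel>T\<parallel> - t\<close>, since a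
product of commuting positive operators is not visibly positive. Requiring it also for the multiples of \<open>P\<close>
by \<open>t\<close>, \<open>\<parallel>T\<parallel> - t\<close> and \<open>t (\<parallel>T\<parallel> - t)\<close> makes the condition stable under these multiplications: a factor that
occurs twice is a square and is absorbed by \<open>\<langle>u, Q(T) P(T) Q(T) u\<rangle> = \<langle>Q(T) u, P(T) Q(T) u\<rangle>\<close>.\<close>

definition positivity_cone :: "'a operator \<Rightarrow> real poly \<Rightarrow> bool"
  where "positivity_cone T P \<longleftrightarrow> form_nonneg T P \<and> form_nonneg T ([:0, 1:] * P) \<and> form_nonneg T ([:norm T, -1:] * P)
    \<and> form_nonneg T ([:0, 1:] * [:norm T, -1:] * P)"

lemma positivity_cone_add: "positivity_cone T P \<Longrightarrow> positivity_cone T Q \<Longrightarrow> positivity_cone T (P + Q)"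
  unfolding positivity_cone_def by (simp only: distrib_left form_nonneg_add)

lemma positivity_cone_const:
  assumes T: "positive_operator T" and M: "0 < norm T" and c: "0 \<le> c"
  shows "positivity_cone T [:c:]"
proof -
  define X Y where "X = [:0, 1 :: real:]" and "Y = [:norm T, -1:]"
  have 1: "form_nonneg T 1" using form_nonneg_const[of 1 T] by (simp add: one_pCons)
  have X: "form_nonneg T X"
    using T by (simp add: form_nonneg_def X_def poly_operator_X positive_operator_def)
  have Y: "form_nonneg T Y"
    unfolding Y_def by (rule form_nonneg_upper)
  \<comment> \<open>Because \<open>X + Y\<close> is the constant \<open>\<parallel>T\<parallel>\<close>; both summands are of the form covered by \<open>form_nonneg_conj\<close>.\<close>
  have "X * Y = smult (1 / norm T) (X * (Y * X) + Y * (X * Y))"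
    using M by (simp add: X_def Y_def)
  moreover have "form_nonneg T (smult (1 / norm T) (X * (Y * X) + Y * (X * Y)))"
    by (intro form_nonneg_smult form_nonneg_add form_nonneg_conj[OF T] X Y) simp
  ultimately have XY: "form_nonneg T (X * Y)" by simp
  have "[:c:] = smult c 1" by simp
  then show ?thesis
    unfolding positivity_cone_def X_def[symmetric] Y_def[symmetric]
    using 1 X Y XY by (simp only: mult_smult_right mult_1_right form_nonneg_smult[OF _ c])
qed

lemma positivity_cone_X:
  assumes T: "positive_operator T" and P: "positivity_cone T P"
  shows "positivity_cone T ([:0, 1:] * P)"
  using P form_nonneg_conj[OF T, of P "[:0,1:]"] form_nonneg_conj[OF T, of "[:norm T, -1:] * P" "[:0,1:]"]
  unfolding positivity_cone_def by (simp only: mult_ac)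

lemma positivity_cone_Y:
  assumes T: "positive_operator T" and P: "positivity_cone T P"
  shows "positivity_cone T ([:norm T, -1:] * P)"
  using P form_nonneg_conj[OF T, of P "[:norm T, -1:]"] form_nonneg_conj[OF T, of "[:0,1:] * P" "[:norm T, -1:]"]
  unfolding positivity_cone_def by (simp only: mult_ac)

lemma positivity_cone_square:
  assumes T: "positive_operator T" and P: "positivity_cone T P"
  shows "positivity_cone T (Q * Q * P)"
  using P form_nonneg_conj[OF T, of P Q] form_nonneg_conj[OF T, of "[:0, 1:] * P" Q]
    form_nonneg_conj[OF T, of "[:norm T, -1:] * P" Q]
    form_nonneg_conj[OF T, of "[:0, 1:] * [:norm T, -1:] * P" Q]
  unfolding positivity_cone_def by (simp only: mult_ac)

text \<open>Induction on the degree. Let \<open>P\<close> attain its minimum \<open>m \<ge> 0\<close> on \<open>[0, \<parallel>T\<parallel>]\<close> at \<open>t\<^sub>0\<close>. Then \<open>P - m\<close> is nonnegative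
and vanishes at \<open>t\<^sub>0\<close>, so it is a polynomial of smaller degree, nonnegative on the interval, times \<open>t\<close>,
\<open>\<parallel>T\<parallel> - t\<close> or \<open>(t - t\<^sub>0)\<^sup>2\<close>, according to whether \<open>t\<^sub>0\<close> is the left end, the right end or an interior point. The
cone is closed under these multiplications and under adding \<open>m\<close>.\<close>

lemma positivity_cone_of_nonneg:
  assumes T: "positive_operator T" and M: "0 < norm T"
  shows "(\<And>t. t \<in> {0..norm T} \<Longrightarrow> 0 \<le> poly P t) \<Longrightarrow> positivity_cone T P"
proof (induction "degree P" arbitrary: P rule: less_induct)
  case less
  show ?case
  proof (cases "degree P = 0")
    case True
    then obtain c where "P = [:c:]" by (metis degree_eq_zeroE)
    with less.prems[of 0] show ?thesis by (simp add: positivity_cone_const[OF T M])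
  next
    case False
    have "\<exists>t0\<in>{0..norm T}. \<forall>t\<in>{0..norm T}. poly P t0 \<le> poly P t"
      by (rule continuous_attains_inf) (auto intro: continuous_intros)
    then obtain t0 where t0: "t0 \<in> {0..norm T}" "\<And>t. t \<in> {0..norm T} \<Longrightarrow> poly P t0 \<le> poly P t"
      by blast
    define m where "m = poly P t0"
    have m: "positivity_cone T [:m:]"
      using less.prems t0(1) by (auto simp: m_def positivity_cone_const[OF T M])
    have "poly (P - [:m:]) t0 = 0" by (simp add: m_def)
    then obtain Q where Q: "P - [:m:] = [:-t0, 1:] * Q"
      unfolding poly_eq_0_iff_dvd by (rule dvdE)
    then have P: "P = [:m:] + [:-t0, 1:] * Q" by (simp add: algebra_simps)
    have "degree (P - [:m:]) = degree P"
      using False by (metis degree_add_eq_left degree_minus degree_pCons_0 diff_conv_add_uminus neq0_conv)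
    then have "degree P = degree ([:-t0, 1:] * Q)" and "Q \<noteq> 0"
      using False Q by auto
    then have deg: "degree P = Suc (degree Q)"
      by (subst (asm) degree_mult_eq) auto
    have Qnn: "0 \<le> (t - t0) * poly Q t" if "t \<in> {0..norm T}" for t
    proof -
      have "(t - t0) * poly Q t = poly (P - [:m:]) t"
        unfolding Q by (simp add: algebra_simps)
      then show ?thesis using t0(2)[OF that] by (simp add: m_def)
    qed
    consider "t0 = 0" | "t0 = norm T" | "0 < t0" "t0 < norm T"
      using t0(1) by fastforce
    then have "positivity_cone T ([:-t0, 1:] * Q)"
    proof cases
      case 1
      have "0 \<le> poly Q t" if "t \<in> {0..norm T}" "t \<noteq> 0" for t
        using Qnn[OF that(1)] that by (simp add: 1 zero_le_mult_iff)
      then have "0 \<le> poly Q t" if "t \<in> {0..norm T}" for t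
        using poly_nonneg_puncture[of 0 "norm T" 0 Q] M that by (cases "t = 0") auto
      then have "positivity_cone T Q" using less.hyps deg by simp
      then show ?thesis using positivity_cone_X[OF T] by (simp add: 1)
    next
      case 2
      have "0 \<le> poly (-Q) t" if "t \<in> {0..norm T}" "t \<noteq> norm T" for t
        using Qnn[OF that(1)] that by (simp add: 2 zero_le_mult_iff)
      then have "0 \<le> poly (-Q) t" if "t \<in> {0..norm T}" for t
        using poly_nonneg_puncture[of 0 "norm T" "norm T" "-Q"] M that by (cases "t = norm T") auto
      then have "positivity_cone T (-Q)" using less.hyps deg by simp
      then have "positivity_cone T ([:norm T, -1:] * (-Q))" by (rule positivity_cone_Y[OF T])
      moreover have "[:norm T, -1:] * (-Q) = [:-t0, 1:] * Q" by (simp add: 2)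
      ultimately show ?thesis by simp
    next
      case 3
      \<comment> \<open>\<open>Q\<close> changes sign at the interior minimum, so it vanishes there and a second linear factor splits off.\<close>
      have right: "0 \<le> poly Q t" if "t \<in> {t0..norm T}" "t \<noteq> t0" for t
        using Qnn[of t] that 3 by (simp add: zero_le_mult_iff)
      have left: "0 \<le> poly (-Q) t" if "t \<in> {0..t0}" "t \<noteq> t0" for t
        using Qnn[of t] that 3 by (simp add: zero_le_mult_iff)
      have "0 \<le> poly Q t0"
        using poly_nonneg_puncture[of t0 "norm T" t0 Q] right 3 by auto
      moreover have "0 \<le> poly (-Q) t0"
        using poly_nonneg_puncture[of 0 t0 t0 "-Q"] left 3 by auto
      ultimately have "poly Q t0 = 0" by simp
      then obtain R where R: "Q = [:-t0, 1:] * R"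
        unfolding poly_eq_0_iff_dvd by (rule dvdE)
      have "0 \<le> poly R t" if "t \<in> {0..norm T}" "t \<noteq> t0" for t
      proof -
        have "0 \<le> (t - t0)\<^sup>2 * poly R t"
          using Qnn[OF that(1)] by (simp add: R power2_eq_square algebra_simps)
        moreover have "0 < (t - t0)\<^sup>2" using that by simp
        ultimately show ?thesis by (meson not_le mult_pos_neg)
      qed
      then have "0 \<le> poly R t" if "t \<in> {0..norm T}" for t
        using poly_nonneg_puncture[of 0 "norm T" t0 R] M t0(1) that by (cases "t = t0") auto
      moreover have "degree R < degree P"
        using deg degree_mult_eq[of "[:-t0, 1:]" R] by (cases "R = 0") (simp_all add: R del: mult_pCons_left)
      ultimately have "positivity_cone T R" using less.hyps by simp
      then have "positivity_cone T ([:-t0, 1:] * [:-t0, 1:] * R)" by (rule positivity_cone_square[OF T])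
      then show ?thesis by (simp only: R mult.assoc)
    qed
    with m have "positivity_cone T ([:m:] + [:-t0, 1:] * Q)" by (rule positivity_cone_add)
    then show ?thesis using P by simp
  qed
qed

text \<open>For \<open>T = 0\<close> the interval degenerates to a point and \<open>P(T)\<close> is the constant \<open>P(0)\<close>; otherwise the cone applies.\<close>

lemma poly_operator_nonneg:
  assumes T: "positive_operator T" and nn: "\<And>t. t \<in> {0..norm T} \<Longrightarrow> 0 \<le> poly P t"
  shows "0 \<le> inner u (blinfun_apply (poly_operator P T) u)"
proof (cases "norm T = 0")
  case True
  have "poly_operator P T = poly P 0 *\<^sub>R id_blinfun"
    using True by (cases P) (simp add: poly_operator_pCons)
  then show ?thesis using nn[of 0] True by (simp add: blinfun.scaleR_left)
next
  case False
  then have "positivity_cone T P" using positivity_cone_of_nonneg[OF T _ nn] by simp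
  then show ?thesis by (simp add: positivity_cone_def form_nonneg_def)
qed

text \<open>Applied to \<open>e\<^sup>2 - P\<^sup>2\<close>, positivity bounds \<open>\<parallel>P(T) u\<parallel>\<^sup>2 = \<langle>u, P(T)\<^sup>2 u\<rangle>\<close>.\<close>

lemma norm_poly_operator_le:
  assumes T: "positive_operator T" and b: "\<And>t. t \<in> {0..norm T} \<Longrightarrow> \<bar>poly P t\<bar> \<le> e"
  shows "norm (poly_operator P T) \<le> e"
proof (rule norm_blinfun_bound)
  show e: "0 \<le> e" using b[of 0] by simp
  fix u
  let ?A = "poly_operator P T"
  have "0 \<le> poly ([:e\<^sup>2:] - P * P) t" if "t \<in> {0..norm T}" for t
    using power_mono[OF b[OF that], of 2] by (simp add: power2_eq_square)
  then have "0 \<le> inner u (blinfun_apply (poly_operator ([:e\<^sup>2:] - P * P) T) u)"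
    by (rule poly_operator_nonneg[OF T])
  also have "\<dots> = e\<^sup>2 * inner u u - inner (blinfun_apply ?A u) (blinfun_apply ?A u)"
    by (simp add: poly_operator_diff poly_operator_const poly_operator_mult blinfun.diff_left
        blinfun.scaleR_left inner_diff_right poly_operator_sym[OF T])
  finally have "(norm (blinfun_apply ?A u))\<^sup>2 \<le> (e * norm u)\<^sup>2"
    by (simp add: power2_norm_eq_inner power_mult_distrib)
  then show "norm (blinfun_apply ?A u) \<le> e * norm u"
    by (rule power2_le_imp_le) (use e in simp)
qed

section \<open>The continuous functional calculus of a positive operator\<close>

text \<open>The limit in the definition of \<open>fun_calc\<close> exists and does not depend on the approximating polynomials, because
\<open>P \<mapsto> P(T)\<close> is contractive for the supremum norm on \<open>[0, \<parallel>T\<parallel>]\<close>. Facts about polynomials pass to continuous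
functions by this lemma.\<close>

lemma poly_operator_tendsto_fun_calc:
  assumes T: "positive_operator T" and P: "uniform_limit {0..norm T} (\<lambda>n. poly (P n)) f sequentially"
  shows "(\<lambda>n. poly_operator (P n) T) \<longlonglongrightarrow> fun_calc f T"
proof -
  have close: "\<forall>\<^sub>F n in sequentially. \<forall>t\<in>{0..norm T}. \<bar>poly (Q n) t - f t\<bar> < e"
    if "uniform_limit {0..norm T} (\<lambda>n. poly (Q n)) f sequentially" "0 < e" for Q :: "nat \<Rightarrow> real poly" and e
    using uniform_limitD[OF that] unfolding dist_real_def .
  have op_close: "norm (poly_operator A T - poly_operator B T) \<le> e"
    if "\<forall>t\<in>{0..norm T}. \<bar>poly A t - f t\<bar> < e / 2" "\<forall>t\<in>{0..norm T}. \<bar>poly B t - f t\<bar> < e / 2" for A B e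
    unfolding poly_operator_diff[symmetric]
  proof (rule norm_poly_operator_le[OF T])
    fix t assume t: "t \<in> {0..norm T}"
    then have "\<bar>poly A t - f t\<bar> < e / 2" "\<bar>poly B t - f t\<bar> < e / 2"
      using that by blast+
    then show "\<bar>poly (A - B) t\<bar> \<le> e"
      unfolding poly_diff by linarith
  qed
  have "Cauchy (\<lambda>n. poly_operator (P n) T)"
  proof (rule CauchyI)
    fix e :: real assume "0 < e"
    then obtain N where N: "\<And>n. N \<le> n \<Longrightarrow> \<forall>t\<in>{0..norm T}. \<bar>poly (P n) t - f t\<bar> < (e / 2) / 2"
      using close[OF P, of "e / 4"] by (auto simp: eventually_sequentially)
    have "norm (poly_operator (P m) T - poly_operator (P n) T) < e" if "N \<le> m" "N \<le> n" for m n
      using op_close[OF N[OF that(1)] N[OF that(2)]] \<open>0 < e\<close> by simp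
    then show "\<exists>N. \<forall>m\<ge>N. \<forall>n\<ge>N. norm (poly_operator (P m) T - poly_operator (P n) T) < e"
      by blast
  qed
  then obtain S where S: "(\<lambda>n. poly_operator (P n) T) \<longlonglongrightarrow> S"
    using Cauchy_convergent convergent_def by blast
  have lim: "(\<lambda>n. poly_operator (Q n) T) \<longlonglongrightarrow> S"
    if Q: "uniform_limit {0..norm T} (\<lambda>n. poly (Q n)) f sequentially" for Q
  proof -
    have "(\<lambda>n. poly_operator (Q n) T - poly_operator (P n) T) \<longlonglongrightarrow> 0"
    proof (rule LIMSEQ_I)
      fix e :: real assume "0 < e"
      then have "\<forall>\<^sub>F n in sequentially. (\<forall>t\<in>{0..norm T}. \<bar>poly (Q n) t - f t\<bar> < (e / 2) / 2)
          \<and> (\<forall>t\<in>{0..norm T}. \<bar>poly (P n) t - f t\<bar> < (e / 2) / 2)"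
        by (intro eventually_conj close P Q) auto
      then obtain N where N: "\<And>n. N \<le> n \<Longrightarrow> (\<forall>t\<in>{0..norm T}. \<bar>poly (Q n) t - f t\<bar> < (e / 2) / 2)
          \<and> (\<forall>t\<in>{0..norm T}. \<bar>poly (P n) t - f t\<bar> < (e / 2) / 2)"
        by (auto simp: eventually_sequentially)
      have "norm (poly_operator (Q n) T - poly_operator (P n) T - 0) < e" if "N \<le> n" for n
        using op_close[of "Q n" "e / 2" "P n"] N[OF that] \<open>0 < e\<close> by simp
      then show "\<exists>N. \<forall>n\<ge>N. norm (poly_operator (Q n) T - poly_operator (P n) T - 0) < e"
        by blast
    qed
    from tendsto_add[OF this S] show ?thesis by simp
  qed
  have "fun_calc f T = S"
    unfolding fun_calc_def
  proof (rule the_equality)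
    fix S' assume "\<forall>P. uniform_limit {0..norm T} (\<lambda>n. poly (P n)) f sequentially \<longrightarrow>
      (\<lambda>n. poly_operator (P n) T) \<longlonglongrightarrow> S'"
    then show "S' = S" using P S LIMSEQ_unique by blast
  qed (use lim in blast)
  with S show ?thesis by simp
qed

lemma polynomials_approximate:
  fixes f :: "real \<Rightarrow> real"
  assumes "continuous_on {0..M} f"
  obtains P :: "nat \<Rightarrow> real poly" where "uniform_limit {0..M} (\<lambda>n. poly (P n)) f sequentially"
proof -
  have "\<exists>P. \<forall>t\<in>{0..M}. \<bar>f t - poly P t\<bar> < inverse (real (Suc n))" for n
  proof -
    obtain g where g: "real_polynomial_function g" "\<And>t. t \<in> {0..M} \<Longrightarrow> \<bar>f t - g t\<bar> < inverse (real (Suc n))"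
      using Stone_Weierstrass_real_polynomial_function[OF compact_Icc assms, of "inverse (real (Suc n))"]
      by auto
    then obtain a k where "g = (\<lambda>x. \<Sum>i\<le>k. a i * x ^ i)"
      by (auto simp: real_polynomial_function_iff_sum)
    then have "g t = poly (\<Sum>i\<le>k. monom (a i) i) t" for t
      by (simp add: poly_sum poly_monom)
    with g(2) show ?thesis by metis
  qed
  then obtain P where P: "\<And>n t. t \<in> {0..M} \<Longrightarrow> \<bar>f t - poly (P n) t\<bar> < inverse (real (Suc n))"
    by metis
  have "uniform_limit {0..M} (\<lambda>n. poly (P n)) f sequentially"
  proof (rule uniform_limitI)
    fix e :: real assume "0 < e"
    then have "\<forall>\<^sub>F n in sequentially. inverse (real (Suc n)) < e"
      using LIMSEQ_inverse_real_of_nat order_tendstoD(2) by blast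
    then show "\<forall>\<^sub>F n in sequentially. \<forall>t\<in>{0..M}. dist (poly (P n) t) (f t) < e"
    proof eventually_elim
      case (elim n)
      then show ?case using P[of _ n] by (force simp: dist_real_def abs_minus_commute)
    qed
  qed
  with that show thesis by blast
qed

lemma fun_calc_poly:
  assumes T: "positive_operator T" and f: "\<And>t. t \<in> {0..norm T} \<Longrightarrow> f t = poly P t"
  shows "fun_calc f T = poly_operator P T"
proof -
  have "uniform_limit {0..norm T} (\<lambda>n. poly P) f sequentially"
    by (rule uniform_limitI) (simp add: f)
  from poly_operator_tendsto_fun_calc[OF T this] show ?thesis
    by (simp add: LIMSEQ_const_iff)
qed

lemma fun_calc_mult:
  assumes T: "positive_operator T" and f: "continuous_on {0..norm T} f" and g: "continuous_on {0..norm T} g"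
  shows "fun_calc (\<lambda>t. f t * g t) T = fun_calc f T o\<^sub>L fun_calc g T"
proof -
  obtain P where P: "uniform_limit {0..norm T} (\<lambda>n. poly (P n)) f sequentially"
    by (rule polynomials_approximate[OF f])
  obtain Q where Q: "uniform_limit {0..norm T} (\<lambda>n. poly (Q n)) g sequentially"
    by (rule polynomials_approximate[OF g])
  have "bounded (f ` {0..norm T})" "bounded (g ` {0..norm T})"
    by (intro compact_imp_bounded compact_continuous_image f g compact_Icc)+
  then have "uniform_limit {0..norm T} (\<lambda>n t. poly (P n) t * poly (Q n) t) (\<lambda>t. f t * g t) sequentially"
    by (intro uniform_lim_mult P Q)
  then have "uniform_limit {0..norm T} (\<lambda>n. poly (P n * Q n)) (\<lambda>t. f t * g t) sequentially"
    by (simp add: poly_mult[abs_def])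
  from poly_operator_tendsto_fun_calc[OF T this]
  have "(\<lambda>n. poly_operator (P n) T o\<^sub>L poly_operator (Q n) T) \<longlonglongrightarrow> fun_calc (\<lambda>t. f t * g t) T"
    by (simp add: poly_operator_mult)
  moreover have "(\<lambda>n. poly_operator (P n) T o\<^sub>L poly_operator (Q n) T) \<longlonglongrightarrow> (fun_calc f T o\<^sub>L fun_calc g T)"
    by (intro bounded_bilinear.tendsto[OF bounded_bilinear_blinfun_compose]
        poly_operator_tendsto_fun_calc[OF T] P Q)
  ultimately show ?thesis by (rule LIMSEQ_unique)
qed

text \<open>The approximating polynomials need not be ordered, but they are up to \<open>2 d\<close>, and this error vanishes in the
limit.\<close>

lemma fun_calc_mono:
  assumes T: "positive_operator T" and f: "continuous_on {0..norm T} f" and g: "continuous_on {0..norm T} g"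
    and le: "\<And>t. t \<in> {0..norm T} \<Longrightarrow> f t \<le> g t"
  shows "inner u (blinfun_apply (fun_calc f T) u) \<le> inner u (blinfun_apply (fun_calc g T) u)"
proof -
  obtain P where P: "uniform_limit {0..norm T} (\<lambda>n. poly (P n)) f sequentially"
    by (rule polynomials_approximate[OF f])
  obtain Q where Q: "uniform_limit {0..norm T} (\<lambda>n. poly (Q n)) g sequentially"
    by (rule polynomials_approximate[OF g])
  define F G where "F n = inner u (blinfun_apply (poly_operator (P n) T) u)"
    and "G n = inner u (blinfun_apply (poly_operator (Q n) T) u)" for n
  have F: "F \<longlonglongrightarrow> inner u (blinfun_apply (fun_calc f T) u)"
    unfolding F_def by (intro tendsto_intros poly_operator_tendsto_fun_calc[OF T] P)
  have G: "G \<longlonglongrightarrow> inner u (blinfun_apply (fun_calc g T) u)"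
    unfolding G_def by (intro tendsto_intros poly_operator_tendsto_fun_calc[OF T] Q)
  show ?thesis
  proof (rule field_le_epsilon)
    fix e :: real assume "0 < e"
    \<comment> \<open>Approximation errors \<open>d\<close> in both functions cost \<open>2 d \<parallel>u\<parallel>\<^sup>2\<close>; adding 1 keeps the denominator nonzero for \<open>u = 0\<close>.\<close>
    define d where "d = e / (2 * (inner u u + 1))"
    have d: "0 < d" "2 * d * inner u u \<le> e"
      using \<open>0 < e\<close> inner_ge_zero[of u] by (auto simp: d_def field_simps add_pos_nonneg)
    have "\<forall>\<^sub>F n in sequentially. (\<forall>t\<in>{0..norm T}. dist (poly (P n) t) (f t) < d)
        \<and> (\<forall>t\<in>{0..norm T}. dist (poly (Q n) t) (g t) < d)"
      by (intro eventually_conj uniform_limitD P Q d)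
    then have "\<forall>\<^sub>F n in sequentially. F n \<le> G n + e"
    proof eventually_elim
      case (elim n)
      have "0 \<le> poly ([:2 * d:] + Q n - P n) t" if "t \<in> {0..norm T}" for t
        using elim le[OF that] that by (force simp: dist_real_def abs_if split: if_splits)
      then have "0 \<le> inner u (blinfun_apply (poly_operator ([:2 * d:] + Q n - P n) T) u)"
        by (rule poly_operator_nonneg[OF T])
      also have "\<dots> = 2 * d * inner u u + G n - F n"
        by (simp add: F_def G_def poly_operator_diff poly_operator_add poly_operator_const
            blinfun.diff_left blinfun.add_left blinfun.scaleR_left inner_diff_right inner_add_right)
      finally show ?case using d(2) by simp
    qed
    then show "inner u (blinfun_apply (fun_calc f T) u) \<le> inner u (blinfun_apply (fun_calc g T) u) + e"
      by (intro tendsto_le[OF _ tendsto_add[OF G tendsto_const] F]) auto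
  qed
qed

lemma fun_calc_positive_operator:
  assumes T: "positive_operator T" and f: "continuous_on {0..norm T} f" and nn: "\<And>t. t \<in> {0..norm T} \<Longrightarrow> 0 \<le> f t"
  shows "positive_operator (fun_calc f T)"
  unfolding positive_operator_def
proof (intro conjI allI)
  fix u v
  obtain P where P: "uniform_limit {0..norm T} (\<lambda>n. poly (P n)) f sequentially"
    by (rule polynomials_approximate[OF f])
  note lim = poly_operator_tendsto_fun_calc[OF T P]
  have "(\<lambda>n. inner (blinfun_apply (poly_operator (P n) T) u) v) \<longlonglongrightarrow> inner (blinfun_apply (fun_calc f T) u) v"
    by (intro tendsto_intros lim)
  moreover have "(\<lambda>n. inner u (blinfun_apply (poly_operator (P n) T) v)) \<longlonglongrightarrow> inner u (blinfun_apply (fun_calc f T) v)"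
    by (intro tendsto_intros lim)
  ultimately show "inner (blinfun_apply (fun_calc f T) u) v = inner u (blinfun_apply (fun_calc f T) v)"
    unfolding poly_operator_sym[OF T] by (rule LIMSEQ_unique)
  have "fun_calc (\<lambda>_. 0) T = 0"
    using fun_calc_poly[OF T, of "\<lambda>_. 0" 0] by simp
  then show "0 \<le> inner u (blinfun_apply (fun_calc f T) u)"
    using fun_calc_mono[OF T continuous_on_const f nn, of u] by simp
qed

section \<open>The absolute value of an operator\<close>

lemma inner_adj:
  assumes "x \<in> bounded_operators"
  shows "inner (blinfun_apply (adj x) u) v = inner u (blinfun_apply x v)"
  by (simp add: inner_ell2_def cinner_adj_left[OF assms])

lemma positive_operator_adj_compose:
  assumes x: "x \<in> bounded_operators"
  shows "positive_operator (adj x o\<^sub>L x)"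
proof -
  have *: "inner u (blinfun_apply (adj x) w) = inner (blinfun_apply x u) w" for u w
    using inner_adj[OF x, of w u] by (simp add: inner_commute)
  show ?thesis by (simp add: positive_operator_def inner_adj[OF x] *)
qed

lemma abs_operator_square:
  assumes x: "x \<in> bounded_operators"
  shows "positive_operator (abs_operator x)" "abs_operator x o\<^sub>L abs_operator x = adj x o\<^sub>L x"
proof -
  note T = positive_operator_adj_compose[OF x]
  show "positive_operator (abs_operator x)"
    unfolding abs_operator_def by (rule fun_calc_positive_operator[OF T]) (auto intro: continuous_intros)
  have "abs_operator x o\<^sub>L abs_operator x = fun_calc (\<lambda>t. sqrt t * sqrt t) (adj x o\<^sub>L x)"
    unfolding abs_operator_def by (rule fun_calc_mult[OF T, symmetric]) (auto intro: continuous_intros)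
  also have "\<dots> = poly_operator [:0, 1:] (adj x o\<^sub>L x)"
    by (rule fun_calc_poly[OF T]) simp
  finally show "abs_operator x o\<^sub>L abs_operator x = adj x o\<^sub>L x"
    by (simp add: poly_operator_X)
qed

lemma norm_abs_operator_apply:
  assumes x: "x \<in> bounded_operators"
  shows "norm (blinfun_apply (abs_operator x) u) = norm (blinfun_apply x u)"
proof -
  have "inner (blinfun_apply (abs_operator x) u) (blinfun_apply (abs_operator x) u)
      = inner u (blinfun_apply (abs_operator x o\<^sub>L abs_operator x) u)"
    using positive_operator_sym[OF abs_operator_square(1)[OF x]] by simp
  also have "\<dots> = inner (blinfun_apply x u) (blinfun_apply x u)"
    unfolding abs_operator_square(2)[OF x]
    using inner_adj[OF x, of "blinfun_apply x u" u] by (simp add: inner_commute)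
  finally show ?thesis by (simp add: norm_eq_sqrt_inner)
qed

lemma norm_abs_operator:
  assumes x: "x \<in> bounded_operators"
  shows "norm (abs_operator x) = norm x"
proof (rule antisym)
  show "norm (abs_operator x) \<le> norm x"
    by (rule norm_blinfun_bound) (simp_all add: norm_abs_operator_apply[OF x] norm_blinfun)
  show "norm x \<le> norm (abs_operator x)"
    by (rule norm_blinfun_bound) (simp_all add: norm_abs_operator_apply[OF x, symmetric] norm_blinfun)
qed

section \<open>Infinite sums of extended nonnegative reals\<close>

lemma infsum_ennreal_SUP:
  fixes f :: "'i \<Rightarrow> ennreal"
  shows "infsum f UNIV = (SUP F\<in>{F. finite F}. sum f F)"
  by (subst nonneg_infsum_complete) auto

lemma sum_le_infsum_ennreal:
  fixes f :: "'i \<Rightarrow> ennreal"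
  shows "finite F \<Longrightarrow> sum f F \<le> infsum f UNIV"
  unfolding infsum_ennreal_SUP by (rule SUP_upper) simp

lemma infsum_cmult_ennreal:
  fixes f :: "'i \<Rightarrow> ennreal"
  shows "(\<Sum>\<^sub>\<infinity>i. c * f i) = c * infsum f UNIV"
  unfolding infsum_ennreal_SUP
  by (simp add: sum_distrib_left[symmetric] SUP_mult_left_ennreal)

lemma infsum_sum_ennreal:
  fixes f :: "'i \<Rightarrow> 'j \<Rightarrow> ennreal"
  assumes "finite F"
  shows "(\<Sum>i\<in>F. infsum (f i) UNIV) = (\<Sum>\<^sub>\<infinity>j. \<Sum>i\<in>F. f i j)"
  using assms by induction (simp_all add: infsum_add nonneg_summable_on_complete)

text \<open>By symmetry one inequality suffices, and for it the outer sum can be taken finite, where the sums exchange by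
additivity.\<close>

lemma infsum_swap_ennreal:
  fixes f :: "'i \<Rightarrow> 'j \<Rightarrow> ennreal"
  shows "(\<Sum>\<^sub>\<infinity>i. \<Sum>\<^sub>\<infinity>j. f i j) = (\<Sum>\<^sub>\<infinity>j. \<Sum>\<^sub>\<infinity>i. f i j)"
proof -
  have le: "(\<Sum>\<^sub>\<infinity>i. \<Sum>\<^sub>\<infinity>j. g i j) \<le> (\<Sum>\<^sub>\<infinity>j. \<Sum>\<^sub>\<infinity>i. g i j)" for g :: "'x \<Rightarrow> 'y \<Rightarrow> ennreal"
    by (subst infsum_ennreal_SUP)
      (auto intro!: SUP_least infsum_mono sum_le_infsum_ennreal simp: infsum_sum_ennreal nonneg_summable_on_complete)
  show ?thesis by (intro antisym le)
qed

lemma infsum_ennreal_le_imp_summable: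
  fixes f :: "'i \<Rightarrow> real"
  assumes nn: "\<And>i. 0 \<le> f i" and le: "(\<Sum>\<^sub>\<infinity>i. ennreal (f i)) \<le> ennreal C" and "0 \<le> C"
  shows "f summable_on UNIV"
proof (rule nonneg_bdd_above_summable_on)
  have "sum f F \<le> C" if "finite F" for F
    using order_trans[OF sum_le_infsum_ennreal[OF that] le] nn \<open>0 \<le> C\<close>
    by (simp add: sum_nonneg sum_ennreal)
  then show "bdd_above (sum f ` {F. F \<subseteq> UNIV \<and> finite F})"
    by (auto simp: bdd_above_def)
qed (rule nn)

section \<open>The Hilbert-Schmidt norm\<close>

text \<open>The square of the norm in \<open>S\<^sub>2\<close>, defined through the matrix so that it is meaningful, possibly with value
\<open>\<infinity>\<close>, for every operator.\<close>

definition hilbert_schmidt_sq :: "'a operator \<Rightarrow> ennreal"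
  where "hilbert_schmidt_sq x = (\<Sum>\<^sub>\<infinity>j. \<Sum>\<^sub>\<infinity>i. ennreal ((cmod (matrix_of x i j))\<^sup>2))"

lemma op_trace_inner: "op_trace T = (\<Sum>\<^sub>\<infinity>i. ennreal (inner (ket i) (blinfun_apply T (ket i))))"
  by (simp add: op_trace_def inner_ell2_def)

text \<open>Both sides add up the squares of the norms of the columns \<open>x e\<^sub>j\<close>.\<close>

lemma op_trace_adj_compose:
  assumes "x \<in> bounded_operators"
  shows "op_trace (adj x o\<^sub>L x) = hilbert_schmidt_sq x"
proof -
  have "inner (ket j) (blinfun_apply (adj x o\<^sub>L x) (ket j)) = (norm (blinfun_apply x (ket j)))\<^sup>2" for j
    using inner_adj[OF assms, of "blinfun_apply x (ket j)" "ket j"]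
    by (simp add: inner_commute power2_norm_eq_inner)
  then show ?thesis
    by (simp only: op_trace_inner hilbert_schmidt_sq_def matrix_of_def ennreal_norm_sq)
qed

text \<open>By the Cauchy-Schwarz inequality for each row of \<open>x\<close>; the rows are the vectors \<open>x\<^sup>* e\<^sub>i\<close> up to conjugation, and
summing over rows or columns first gives the same total.\<close>

lemma norm_le_hs:
  assumes x: "x \<in> bounded_operators"
  shows "ennreal ((norm x)\<^sup>2) \<le> hilbert_schmidt_sq x"
proof -
  have apply_le: "ennreal ((norm (blinfun_apply x u))\<^sup>2) \<le> ennreal ((norm u)\<^sup>2) * hilbert_schmidt_sq x" for u
  proof -
    have coord: "coord (blinfun_apply x u) i = cinner (blinfun_apply (adj x) (ket i)) u" for u i
      by (simp add: cinner_adj_left[OF x] cinner_ket_left)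
    have mat: "cmod (coord (blinfun_apply (adj x) (ket i)) j) = cmod (matrix_of x i j)" for i j
    proof -
      have "matrix_of x i j = cnj (coord (blinfun_apply (adj x) (ket i)) j)"
        unfolding matrix_of_def coord by (subst cinner_commute) (simp add: cinner_ket_left)
      then show ?thesis by simp
    qed
    have "ennreal ((norm (blinfun_apply x u))\<^sup>2) = (\<Sum>\<^sub>\<infinity>i. ennreal ((cmod (coord (blinfun_apply x u) i))\<^sup>2))"
      by (simp only: ennreal_norm_sq)
    also have "\<dots> \<le> (\<Sum>\<^sub>\<infinity>i. ennreal ((norm u)\<^sup>2) * ennreal ((norm (blinfun_apply (adj x) (ket i)))\<^sup>2))"
    proof (rule infsum_mono)
      fix i
      have "(cmod (coord (blinfun_apply x u) i))\<^sup>2 \<le> (norm (blinfun_apply (adj x) (ket i)) * norm u)\<^sup>2"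
        unfolding coord by (intro power_mono cinner_cauchy_schwarz) simp
      then show "ennreal ((cmod (coord (blinfun_apply x u) i))\<^sup>2)
          \<le> ennreal ((norm u)\<^sup>2) * ennreal ((norm (blinfun_apply (adj x) (ket i)))\<^sup>2)"
        by (simp add: ennreal_mult[symmetric] power_mult_distrib mult.commute)
    qed (simp_all add: nonneg_summable_on_complete)
    also have "\<dots> = ennreal ((norm u)\<^sup>2) * hilbert_schmidt_sq x"
      by (simp only: infsum_cmult_ennreal hilbert_schmidt_sq_def ennreal_norm_sq[symmetric] mat infsum_swap_ennreal[of "\<lambda>j i. ennreal ((cmod (matrix_of x i j))\<^sup>2)"])
    finally show ?thesis .
  qed
  show ?thesis
  proof (cases "hilbert_schmidt_sq x")
    case (real h)
    have "norm x \<le> sqrt h"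
    proof (rule norm_blinfun_bound)
      fix u
      have "(norm (blinfun_apply x u))\<^sup>2 \<le> (norm u)\<^sup>2 * h"
        using apply_le[of u] real by (simp add: ennreal_mult[symmetric])
      also have "\<dots> = (sqrt h * norm u)\<^sup>2"
        using real by (simp add: power_mult_distrib)
      finally show "norm (blinfun_apply x u) \<le> sqrt h * norm u"
        by (rule power2_le_imp_le) (use real in simp)
    qed (use real in simp)
    then have "(norm x)\<^sup>2 \<le> h"
      using real by (simp add: real_le_rsqrt sqrt_ge_absD)
    then show ?thesis using real by (simp add: ennreal_leI)
  qed simp
qed

text \<open>A Hilbert-Schmidt matrix defines a bounded operator, by the Cauchy-Schwarz inequality for each row.\<close>

lemma operator_of_matrix:
  fixes b :: "'a \<Rightarrow> 'a \<Rightarrow> complex"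
  assumes b: "(\<Sum>\<^sub>\<infinity>j. \<Sum>\<^sub>\<infinity>i. ennreal ((cmod (b i j))\<^sup>2)) < \<infinity>"
  obtains y where "y \<in> bounded_operators" "\<And>i j. matrix_of y i j = b i j"
proof -
  obtain B where B: "0 \<le> B" "(\<Sum>\<^sub>\<infinity>i. \<Sum>\<^sub>\<infinity>j. ennreal ((cmod (b i j))\<^sup>2)) = ennreal B"
  proof (cases "\<Sum>\<^sub>\<infinity>i. \<Sum>\<^sub>\<infinity>j. ennreal ((cmod (b i j))\<^sup>2)")
    case top
    then show ?thesis using b by (simp add: infsum_swap_ennreal[of "\<lambda>j i. ennreal ((cmod (b i j))\<^sup>2)"])
  qed (use that in blast)
  define R where "R i = Abs_ell2 (\<lambda>j. cnj (b i j))" for i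
  have R: "coord (R i) j = cnj (b i j)" for i j
  proof -
    have "(\<Sum>\<^sub>\<infinity>j. ennreal ((cmod (b i j))\<^sup>2)) \<le> ennreal B"
      using sum_le_infsum_ennreal[of "{i}" "\<lambda>i. \<Sum>\<^sub>\<infinity>j. ennreal ((cmod (b i j))\<^sup>2)"] B by simp
    then have "(\<lambda>j. (cmod (b i j))\<^sup>2) summable_on UNIV"
      by (rule infsum_ennreal_le_imp_summable[rotated]) (use B in auto)
    then show ?thesis by (simp add: R_def Abs_ell2_inverse)
  qed
  have rows: "(\<Sum>i\<in>F. (norm (R i))\<^sup>2) \<le> B" if "finite F" for F
  proof -
    have "ennreal (\<Sum>i\<in>F. (norm (R i))\<^sup>2) = (\<Sum>i\<in>F. ennreal ((norm (R i))\<^sup>2))"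
      by (simp add: sum_ennreal)
    also have "\<dots> = (\<Sum>i\<in>F. \<Sum>\<^sub>\<infinity>j. ennreal ((cmod (b i j))\<^sup>2))"
      by (simp add: ennreal_norm_sq[symmetric] R)
    also have "\<dots> \<le> ennreal B"
      unfolding B(2)[symmetric] by (rule sum_le_infsum_ennreal[OF that])
    finally show ?thesis using B(1) by simp
  qed
  have "(\<Sum>i\<in>F. (cmod (cinner (R i) u))\<^sup>2) \<le> (sqrt B)\<^sup>2 * (norm u)\<^sup>2" if "finite F" for F u
  proof -
    have "(\<Sum>i\<in>F. (cmod (cinner (R i) u))\<^sup>2) \<le> (\<Sum>i\<in>F. (norm (R i) * norm u)\<^sup>2)"
      by (intro sum_mono power_mono cinner_cauchy_schwarz) simp
    also have "\<dots> = (\<Sum>i\<in>F. (norm (R i))\<^sup>2) * (norm u)\<^sup>2"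
      by (simp add: power_mult_distrib sum_distrib_right)
    also have "\<dots> \<le> B * (norm u)\<^sup>2"
      by (intro mult_right_mono rows that) simp
    finally show ?thesis using B(1) by simp
  qed
  then obtain y where y: "y \<in> bounded_operators" "\<And>u i. coord (blinfun_apply y u) i = cinner (R i) u"
    using operator_of_rows[of R "sqrt B"] B(1) by auto
  have "matrix_of y i j = b i j" for i j
  proof -
    have "matrix_of y i j = cnj (cinner (ket j) (R i))"
      by (simp add: matrix_of_def y flip: cinner_commute)
    then show ?thesis by (simp add: cinner_ket_left R)
  qed
  with y(1) that show thesis by blast
qed

section \<open>Comparison of Schatten norms with the Hilbert-Schmidt norm\<close>

text \<open>Monotonicity of the calculus compares the diagonal entries, and its multiplicativity lets the constant factor
come out.\<close>

lemma op_trace_fun_calc_le: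
  assumes S: "positive_operator S" and f: "continuous_on {0..norm S} f" and g: "continuous_on {0..norm S} g"
    and c: "0 \<le> c" and le: "\<And>t. t \<in> {0..norm S} \<Longrightarrow> f t \<le> c * g t"
  shows "op_trace (fun_calc f S) \<le> ennreal c * op_trace (fun_calc g S)"
proof -
  have "fun_calc (\<lambda>t. c * g t) S = fun_calc (\<lambda>_. c) S o\<^sub>L fun_calc g S"
    by (rule fun_calc_mult[OF S continuous_on_const g])
  also have "fun_calc (\<lambda>_. c) S = poly_operator [:c:] S"
    by (rule fun_calc_poly[OF S]) simp
  finally have cg: "blinfun_apply (fun_calc (\<lambda>t. c * g t) S) u = c *\<^sub>R blinfun_apply (fun_calc g S) u" for u
    by (simp add: poly_operator_const blinfun.scaleR_left)
  have "op_trace (fun_calc f S) \<le> op_trace (fun_calc (\<lambda>t. c * g t) S)"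
    unfolding op_trace_inner
    by (intro infsum_mono nonneg_summable_on_complete zero_le ennreal_leI fun_calc_mono[OF S f _ le]
        continuous_on_mult continuous_on_const g)
  also have "\<dots> = ennreal c * op_trace (fun_calc g S)"
    using c by (simp add: op_trace_inner cg ennreal_mult' infsum_cmult_ennreal)
  finally show ?thesis .
qed

lemma continuous_on_powr_nonneg: "0 < p \<Longrightarrow> continuous_on {0..M} (\<lambda>t::real. t powr p)"
  by (intro continuous_on_powr' continuous_intros) auto

lemma hs_abs_operator:
  assumes x: "x \<in> bounded_operators"
  shows "hilbert_schmidt_sq x = op_trace (fun_calc (\<lambda>t. t\<^sup>2) (abs_operator x))"
proof -
  note S = abs_operator_square[OF x]
  have "fun_calc (\<lambda>t. t\<^sup>2) (abs_operator x) = poly_operator ([:0, 1:] * [:0, 1:]) (abs_operator x)"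
    by (rule fun_calc_poly[OF S(1)]) (simp add: power2_eq_square)
  also have "\<dots> = adj x o\<^sub>L x"
    by (simp only: poly_operator_mult poly_operator_X S(2))
  finally show ?thesis by (simp only: op_trace_adj_compose[OF x])
qed

lemma hs_le_trace_abs_powr:
  assumes x: "x \<in> bounded_operators" and p: "0 < p" "p \<le> 2"
  shows "hilbert_schmidt_sq x \<le> ennreal (norm x powr (2 - p)) * trace_abs_powr p x"
  unfolding hs_abs_operator[OF x] trace_abs_powr_def
proof (rule op_trace_fun_calc_le[OF abs_operator_square(1)[OF x]])
  fix t :: real assume "t \<in> {0..norm (abs_operator x)}"
  then have t: "0 \<le> t" "t \<le> norm x" by (auto simp: norm_abs_operator[OF x])
  show "t\<^sup>2 \<le> norm x powr (2 - p) * t powr p"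
  proof (cases "t = 0")
    case False
    have "t\<^sup>2 = t powr (2 - p) * t powr p"
      using t False by (simp add: powr_add[symmetric])
    also have "\<dots> \<le> norm x powr (2 - p) * t powr p"
      using t p by (intro mult_right_mono powr_mono2) auto
    finally show ?thesis .
  qed simp
qed (use p in \<open>auto intro!: continuous_intros continuous_on_powr_nonneg\<close>)

lemma trace_abs_powr_le_hs:
  assumes x: "x \<in> bounded_operators" and q: "2 \<le> q"
  shows "trace_abs_powr q x \<le> ennreal (norm x powr (q - 2)) * hilbert_schmidt_sq x"
  unfolding hs_abs_operator[OF x] trace_abs_powr_def
proof (rule op_trace_fun_calc_le[OF abs_operator_square(1)[OF x]])
  fix t :: real assume "t \<in> {0..norm (abs_operator x)}"
  then have t: "0 \<le> t" "t \<le> norm x" by (auto simp: norm_abs_operator[OF x])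
  show "t powr q \<le> norm x powr (q - 2) * t\<^sup>2"
  proof (cases "t = 0")
    case False
    have "t powr q = t powr (q - 2) * t powr 2"
      by (simp add: powr_add[symmetric])
    also have "\<dots> \<le> norm x powr (q - 2) * t powr 2"
      using t q by (intro mult_right_mono powr_mono2) auto
    finally show ?thesis using t False by simp
  qed simp
qed (use q in \<open>auto intro!: continuous_intros continuous_on_powr_nonneg\<close>)

text \<open>The inclusion of \<open>S\<^sub>p\<close> in \<open>S\<^sub>2\<close> is a contraction for \<open>p \<le> 2\<close>. With \<open>M = \<parallel>x\<parallel>\<close>, the assumption gives
\<open>M\<^sup>2 \<le> \<parallel>x\<parallel>\<^sub>2\<^sup>2 \<le> M\<^sup>2\<^sup>-\<^sup>p\<close>. This excludes \<open>M > 1\<close>, and then the second inequality bounds \<open>\<parallel>x\<parallel>\<^sub>2\<close> by 1.\<close>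

lemma hs_le_one:
  assumes x: "x \<in> bounded_operators" and p: "0 < p" "p \<le> 2" and le: "trace_abs_powr p x \<le> 1"
  shows "hilbert_schmidt_sq x \<le> 1"
proof -
  have *: "hilbert_schmidt_sq x \<le> ennreal (norm x powr (2 - p))"
    using hs_le_trace_abs_powr[OF x p] mult_left_mono[OF le, of "ennreal (norm x powr (2 - p))"]
    by simp
  have "ennreal ((norm x)\<^sup>2) \<le> ennreal (norm x powr (2 - p))"
    using norm_le_hs[OF x] * by (rule order_trans)
  then have sq: "(norm x)\<^sup>2 \<le> norm x powr (2 - p)" by simp
  have "norm x \<le> 1"
  proof (rule ccontr)
    assume gt: "\<not> norm x \<le> 1"
    then have "norm x powr 2 \<le> norm x powr (2 - p)" using sq by simp
    then show False using powr_le_cancel_iff[of "norm x" 2 "2 - p"] gt p by simp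
  qed
  then have "norm x powr (2 - p) \<le> 1"
    using p by (intro powr_le1) auto
  then have "ennreal (norm x powr (2 - p)) \<le> 1" by simp
  with * show ?thesis by (rule order_trans)
qed

text \<open>The inclusion of \<open>S\<^sub>2\<close> in \<open>S\<^sub>q\<close> is a contraction for \<open>q \<ge> 2\<close>: the factor \<open>\<parallel>x\<parallel>\<^sup>q\<^sup>-\<^sup>2\<close> in \<open>trace_abs_powr_le_hs\<close> is at
most \<open>N\<^sup>q\<^sup>-\<^sup>2\<close> because the operator norm is at most the Hilbert-Schmidt norm.\<close>

lemma schatten_norm_le_hs:
  assumes x: "x \<in> bounded_operators" and q: "2 \<le> q" and N: "0 \<le> N" and le: "hilbert_schmidt_sq x \<le> ennreal (N\<^sup>2)"
  shows "schatten_norm q x \<le> N"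
proof -
  have "ennreal ((norm x)\<^sup>2) \<le> ennreal (N\<^sup>2)"
    using norm_le_hs[OF x] le by (rule order_trans)
  then have "(norm x)\<^sup>2 \<le> N\<^sup>2"
    by (subst (asm) ennreal_le_iff) simp_all
  then have nx: "norm x \<le> N"
    using N by (rule power2_le_imp_le)
  have "trace_abs_powr q x \<le> ennreal (norm x powr (q - 2)) * hilbert_schmidt_sq x"
    by (rule trace_abs_powr_le_hs[OF x q])
  also have "\<dots> \<le> ennreal (N powr (q - 2)) * ennreal (N\<^sup>2)"
    using nx q by (intro mult_mono le ennreal_leI powr_mono2) auto
  also have "\<dots> = ennreal (N powr q)"
  proof (cases "N = 0")
    case False
    then have "N powr (q - 2) * N\<^sup>2 = N powr (q - 2) * N powr 2" using N by simp
    also have "\<dots> = N powr q" by (simp add: powr_add[symmetric])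
    finally show ?thesis by (simp add: ennreal_mult[symmetric])
  qed simp
  finally have "enn2real (trace_abs_powr q x) \<le> N powr q"
    by (intro enn2real_leI) auto
  then have "schatten_norm q x \<le> (N powr q) powr (1 / q)"
    unfolding schatten_norm_def using q by (intro powr_mono2) auto
  also have "\<dots> = N" using q N by (simp add: powr_powr)
  finally show ?thesis .
qed

section \<open>Schur multipliers and the weak norm\<close>

lemma ennreal_cmult_finite:
  assumes "A \<le> ennreal c * B" and "B < \<infinity>"
  shows "A < \<infinity>"
  by (rule le_less_trans[OF assms(1)]) (use assms(2) in \<open>simp add: ennreal_mult_less_top\<close>)

lemma schur_multiplier_eqI:
  assumes "y \<in> bounded_operators" "\<And>i j. matrix_of y i j = a i j * matrix_of x i j"
  shows "schur_multiplier a x = y"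
  unfolding schur_multiplier_def
proof (rule the_equality)
  fix z assume "z \<in> bounded_operators \<and> (\<forall>i j. matrix_of z i j = a i j * matrix_of x i j)"
  then show "z = y"
    by (intro matrix_of_inject) (simp_all add: assms)
qed (simp add: assms)

text \<open>If the matrix of \<open>x\<close> is square-summable, so is its entrywise product with the bounded symbol \<open>a\<close>, and a
square-summable matrix is the matrix of an operator.\<close>

lemma schur_multiplier_hs:
  fixes x :: "'a operator"
  assumes a: "\<And>i j. cmod (a i j) \<le> N" and "hilbert_schmidt_sq x < \<infinity>"
  shows "schur_multiplier a x \<in> bounded_operators"
    and "matrix_of (schur_multiplier a x) i j = a i j * matrix_of x i j"
    and "hilbert_schmidt_sq (schur_multiplier a x) \<le> ennreal (N\<^sup>2) * hilbert_schmidt_sq x"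
proof -
  have le: "(\<Sum>\<^sub>\<infinity>j. \<Sum>\<^sub>\<infinity>i. ennreal ((cmod (a i j * matrix_of x i j))\<^sup>2)) \<le> ennreal (N\<^sup>2) * hilbert_schmidt_sq x"
    unfolding hilbert_schmidt_sq_def infsum_cmult_ennreal[symmetric]
  proof (intro infsum_mono nonneg_summable_on_complete zero_le)
    fix i j
    have "(cmod (a i j * matrix_of x i j))\<^sup>2 \<le> N\<^sup>2 * (cmod (matrix_of x i j))\<^sup>2"
      unfolding norm_mult power_mult_distrib by (intro mult_right_mono power_mono a) auto
    then show "ennreal ((cmod (a i j * matrix_of x i j))\<^sup>2) \<le> ennreal (N\<^sup>2) * ennreal ((cmod (matrix_of x i j))\<^sup>2)"
      by (simp add: ennreal_mult[symmetric])
  qed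
  obtain y where y: "y \<in> bounded_operators" "\<And>i j. matrix_of y i j = a i j * matrix_of x i j"
    using operator_of_matrix[OF ennreal_cmult_finite[OF le \<open>hilbert_schmidt_sq x < \<infinity>\<close>]] by blast
  note eq = schur_multiplier_eqI[OF y]
  show "schur_multiplier a x \<in> bounded_operators"
    and "matrix_of (schur_multiplier a x) i j = a i j * matrix_of x i j"
    by (simp_all add: eq y)
  show "hilbert_schmidt_sq (schur_multiplier a x) \<le> ennreal (N\<^sup>2) * hilbert_schmidt_sq x"
    using le by (simp add: hilbert_schmidt_sq_def eq y)
qed

lemma hs_finite_of_schatten:
  assumes x: "x \<in> schatten_class p" and p: "0 < p" "p \<le> 2"
  shows "hilbert_schmidt_sq x < \<infinity>"
proof -
  have "x \<in> bounded_operators" "trace_abs_powr p x < \<infinity>"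
    using x by (simp_all add: schatten_class_def)
  then show ?thesis
    using ennreal_cmult_finite[OF hs_le_trace_abs_powr[OF _ p]] by blast
qed

lemma schatten_class_of_hs_finite:
  assumes y: "y \<in> bounded_operators" "hilbert_schmidt_sq y < \<infinity>" and q: "2 \<le> q"
  shows "y \<in> schatten_class q"
  using ennreal_cmult_finite[OF trace_abs_powr_le_hs[OF y(1) q] y(2)] y(1) by (simp add: schatten_class_def)

lemma schur_norm_le_sup:
  fixes a :: "'a \<Rightarrow> 'a \<Rightarrow> complex"
  assumes p: "0 < p" "p \<le> 2" and q: "2 \<le> q" and N: "0 \<le> N" and a: "\<And>i j. cmod (a i j) \<le> N"
  shows "schur_norm p q a \<le> ennreal N"
proof -
  have "schur_maps p q a"
    unfolding schur_maps_def
  proof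
    fix x :: "'a operator" assume "x \<in> schatten_class p"
    then have fin: "hilbert_schmidt_sq x < \<infinity>" by (rule hs_finite_of_schatten[OF _ p])
    note y = schur_multiplier_hs[of a N x, OF a fin]
    have "schur_multiplier a x \<in> schatten_class q"
      by (rule schatten_class_of_hs_finite[OF y(1) ennreal_cmult_finite[OF y(3) fin] q])
    then show "\<exists>y\<in>schatten_class q. \<forall>i j. matrix_of y i j = a i j * matrix_of x i j"
      using y(2) by blast
  qed
  moreover have "schatten_norm q (schur_multiplier a x) \<le> N"
    if x: "x \<in> schatten_class p" "schatten_norm p x \<le> 1" for x
  proof -
    have bx: "x \<in> bounded_operators" and tx: "trace_abs_powr p x < \<infinity>"
      using x by (auto simp: schatten_class_def)
    note y = schur_multiplier_hs[of a N x, OF a hs_finite_of_schatten[OF x(1) p]]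
    have "enn2real (trace_abs_powr p x) \<le> 1"
    proof (rule ccontr)
      assume "\<not> enn2real (trace_abs_powr p x) \<le> 1"
      then have "1 < enn2real (trace_abs_powr p x) powr (1 / p)"
        using p by (intro gr_one_powr) auto
      then show False using x(2) by (simp add: schatten_norm_def)
    qed
    then have "trace_abs_powr p x \<le> 1"
      using tx by (cases "trace_abs_powr p x") auto
    then have "hilbert_schmidt_sq x \<le> 1" by (rule hs_le_one[OF bx p])
    then have "hilbert_schmidt_sq (schur_multiplier a x) \<le> ennreal (N\<^sup>2)"
      using order_trans[OF y(3) mult_left_mono[of "hilbert_schmidt_sq x" 1 "ennreal (N\<^sup>2)"]] by simp
    then show ?thesis
      by (rule schatten_norm_le_hs[OF y(1) q N])
  qed
  ultimately show ?thesis
    unfolding schur_norm_def by (auto intro!: SUP_least ennreal_leI)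
qed

text \<open>For finite \<open>r\<close>, the value \<open>t = 1\<close> in the supremum: fewer than one entry exceeds \<open>s\<close> only if none does, so
\<open>\<mu>\<^sub>1(a)\<close> is an upper bound of all entries.\<close>

lemma cmod_le_weak_norm:
  assumes "1 < r"
  shows "ennreal (cmod (a i j)) \<le> weak_norm r a"
proof (cases "r = \<infinity>")
  case True
  have "ennreal (cmod (a i j)) \<le> (SUP (i, j). ennreal (cmod (a i j)))"
    by (rule SUP_upper2[of "(i, j)"]) auto
  then show ?thesis by (simp add: weak_norm_def True)
next
  case False
  have "ennreal (cmod (a i j)) \<le> decr_rearr a 1"
    unfolding decr_rearr_def
  proof (rule Inf_greatest, safe)
    fix s :: real assume s: "0 < s" "emeasure (count_space UNIV) {(i, j). s < cmod (a i j)} < ennreal 1"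
    have "\<not> s < cmod (a i j)"
    proof
      assume "s < cmod (a i j)"
      then have "emeasure (count_space UNIV) {(i, j)} \<le> emeasure (count_space UNIV) {(i, j). s < cmod (a i j)}"
        by (intro emeasure_mono) auto
      with s(2) show False by simp
    qed
    then show "ennreal (cmod (a i j)) \<le> ennreal s" by (simp add: ennreal_leI)
  qed
  also have "\<dots> = ennreal (1 powr (1 / real_of_ereal r)) * decr_rearr a 1" by simp
  also have "\<dots> \<le> weak_norm r a"
    unfolding weak_norm_def if_not_P[OF False] by (rule SUP_upper) simp
  finally show ?thesis .
qed

lemma schur_norm_le_weak_norm:
  assumes "0 < p" "p \<le> 2" "2 \<le> q" "1 < r"
  shows "schur_norm p q a \<le> weak_norm r a"
proof (cases "weak_norm r a")
  case (real N)
  have "cmod (a i j) \<le> N" for i j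
    using cmod_le_weak_norm[OF \<open>1 < r\<close>, of a i j] real by simp
  then show ?thesis
    using schur_norm_le_sup[OF assms(1-3), of N a] real by simp
qed simp

section \<open>Optimality of the constant one\<close>

definition matrix_unit :: "'a \<Rightarrow> 'a \<Rightarrow> 'a \<Rightarrow> complex"
  where "matrix_unit k i j = (if i = k \<and> j = k then 1 else 0)"

text \<open>\<open>\<mu>\<^sub>t\<close> is at most 1 for \<open>t \<le> 1\<close> and vanishes for \<open>t > 1\<close>.\<close>

lemma weak_norm_matrix_unit:
  assumes "1 < r"
  shows "weak_norm r (matrix_unit k) \<le> 1"
proof (cases "r = \<infinity>")
  case True
  then show ?thesis
    by (auto simp: weak_norm_def matrix_unit_def intro!: SUP_least)
next
  case False
  then have r: "0 < 1 / real_of_ereal r"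
    using assms by (cases r) auto
  have "ennreal (t powr (1 / real_of_ereal r)) * decr_rearr (matrix_unit k) t \<le> 1" if t: "0 < t" for t
  proof (cases "t \<le> 1")
    case True
    have "{(i, j). 1 < cmod (matrix_unit k i j)} = {}"
      by (auto simp: matrix_unit_def split: if_splits)
    then have "decr_rearr (matrix_unit k) t \<le> ennreal 1"
      unfolding decr_rearr_def using t by (intro Inf_lower imageI) simp
    moreover have "ennreal (t powr (1 / real_of_ereal r)) \<le> ennreal 1"
      using t True r by (intro ennreal_leI powr_le1) auto
    ultimately show ?thesis
      using mult_mono[of "ennreal (t powr (1 / real_of_ereal r))" 1 "decr_rearr (matrix_unit k) t" 1] by simp
  next
    case False
    have le: "decr_rearr (matrix_unit k) t \<le> ennreal s" if s: "0 < s" for s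
    proof -
      have "{(i, j). s < cmod (matrix_unit k i j)} \<subseteq> {(k, k)}"
        using s by (auto simp: matrix_unit_def split: if_splits)
      then have "emeasure (count_space UNIV) {(i, j). s < cmod (matrix_unit k i j)}
          \<le> emeasure (count_space UNIV) {(k, k)}"
        by (intro emeasure_mono) auto
      also have "\<dots> < ennreal t" using False by simp
      finally show ?thesis
        unfolding decr_rearr_def using s by (intro Inf_lower imageI) simp
    qed
    have "decr_rearr (matrix_unit k) t \<le> 0"
      by (rule ennreal_le_epsilon) (simp add: le)
    then show ?thesis by simp
  qed
  then show ?thesis
    unfolding weak_norm_def if_not_P[OF False] by (auto intro!: SUP_least)
qed

text \<open>For an idempotent \<open>T\<close> one has \<open>f(T) = f(0) (1 - T) + f(1) T\<close>, first for polynomials and then in the limit. The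
bound \<open>1 \<le> \<parallel>T\<parallel>\<close> puts the point 1 into the interval on which \<open>f\<close> is approximated.\<close>

lemma fun_calc_idempotent:
  assumes T: "positive_operator T" "T o\<^sub>L T = T" and "1 \<le> norm T"
    and f: "continuous_on {0..norm T} f" "f 0 = 0" "f 1 = 1"
  shows "fun_calc f T = T"
proof -
  have poly: "poly_operator P T = poly P 0 *\<^sub>R (id_blinfun - T) + poly P 1 *\<^sub>R T" for P
  proof (induction P)
    case (pCons c P)
    have "T o\<^sub>L (id_blinfun - T) = 0"
    proof -
      have "T o\<^sub>L id_blinfun = T" by (rule blinfun_eqI) simp
      then show ?thesis
        by (simp add: bounded_bilinear.diff_right[OF bounded_bilinear_blinfun_compose] T(2))
    qed
    then have "T o\<^sub>L poly_operator P T = poly P 1 *\<^sub>R T"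
      by (simp add: pCons.IH T(2) bounded_bilinear.add_right[OF bounded_bilinear_blinfun_compose]
          bounded_bilinear.scaleR_right[OF bounded_bilinear_blinfun_compose])
    then show ?case by (simp add: poly_operator_pCons algebra_simps)
  qed simp
  obtain P where P: "uniform_limit {0..norm T} (\<lambda>n. poly (P n)) f sequentially"
    by (rule polynomials_approximate[OF f(1)])
  have "(\<lambda>n. poly (P n) t) \<longlonglongrightarrow> f t" if "t \<in> {0..norm T}" for t
    by (rule tendsto_uniform_limitI[OF P that])
  from this[of 0] this[of 1]
  have "(\<lambda>n. poly_operator (P n) T) \<longlonglongrightarrow> f 0 *\<^sub>R (id_blinfun - T) + f 1 *\<^sub>R T"
    unfolding poly using \<open>1 \<le> norm T\<close> by (intro tendsto_intros) auto
  then show ?thesis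
    using LIMSEQ_unique[OF poly_operator_tendsto_fun_calc[OF T(1) P]] f by simp
qed

lemma cinner_zero_left: "cinner 0 u = 0"
  by (simp add: cinner.rep_eq zero_ell2.rep_eq)

text \<open>The projection onto a basis vector is its own absolute value and equals all its powers, so all its Schatten
norms are 1.\<close>

lemma rank_one_projection:
  fixes k :: 'a
  obtains E :: "'a operator" where "E \<in> bounded_operators" "\<And>i j. matrix_of E i j = matrix_unit k i j"
    "\<And>p. 0 < p \<Longrightarrow> trace_abs_powr p E = 1"
proof -
  have "(\<Sum>i\<in>F. (cmod (cinner (if i = k then ket i else 0) u))\<^sup>2) \<le> 1\<^sup>2 * (norm u)\<^sup>2" if "finite F" for F and u :: "'a ell2"
  proof -
    have "(\<Sum>i\<in>F. (cmod (cinner (if i = k then ket i else 0) u))\<^sup>2) \<le> (\<Sum>i\<in>F. if i = k then (cmod (coord u k))\<^sup>2 else 0)"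
      by (intro sum_mono) (simp add: cinner_ket_left cinner_zero_left)
    also have "\<dots> \<le> (cmod (coord u k))\<^sup>2"
      using that by simp
    also have "\<dots> \<le> (norm u)\<^sup>2"
      by (intro power_mono cmod_coord_le) simp
    finally show ?thesis by simp
  qed
  then obtain E :: "'a operator" where bE: "E \<in> bounded_operators"
      and E': "\<And>u i. coord (blinfun_apply E u) i = cinner (if i = k then ket i else 0) u"
    using operator_of_rows[of "\<lambda>i. if i = k then ket i else 0" 1] by auto
  have E: "blinfun_apply E u = scaleC (coord u k) (ket k)" for u
    by (rule coord_eqI) (simp add: E' scaleC.rep_eq coord_ket cinner_ket_left cinner_zero_left)
  have mat: "matrix_of E i j = matrix_unit k i j" for i j
    by (simp add: matrix_of_def E matrix_unit_def scaleC.rep_eq coord_ket)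
  have sym: "cinner (blinfun_apply E u) v = cinner u (blinfun_apply E v)" for u v
  proof -
    have "cinner u (ket k) = cnj (coord u k)"
      by (subst cinner_commute) (simp add: cinner_ket_left)
    then show ?thesis
      by (simp add: E cinner_scaleC_left cinner_scaleC_right cinner_ket_left)
  qed
  have EE: "E o\<^sub>L E = E"
    by (rule blinfun_eqI) (simp add: E scaleC.rep_eq coord_ket)
  have "0 \<le> inner u (blinfun_apply E u)" for u
  proof -
    have "inner u (blinfun_apply E u) = inner (blinfun_apply E u) (blinfun_apply E u)"
      by (metis EE blinfun_apply_blinfun_compose inner_ell2_def sym)
    then show ?thesis by simp
  qed
  then have pos: "positive_operator E"
    by (simp add: positive_operator_def inner_ell2_def sym)
  have "blinfun_apply E (ket k) = ket k"
    by (rule coord_eqI) (simp add: E scaleC.rep_eq coord_ket)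
  then have nE: "1 \<le> norm E"
    using norm_blinfun[of E "ket k"] by (simp add: norm_ket)
  have abs: "abs_operator E = E"
    unfolding abs_operator_def adj_eqI[OF sym] EE
    by (rule fun_calc_idempotent[OF pos EE nE]) (auto intro: continuous_intros)
  have "trace_abs_powr p E = 1" if "0 < p" for p
  proof -
    have "trace_abs_powr p E = op_trace E"
      unfolding trace_abs_powr_def abs
      by (subst fun_calc_idempotent[OF pos EE nE continuous_on_powr_nonneg[OF that]]) auto
    also have "\<dots> = (\<Sum>\<^sub>\<infinity>i. if i = k then 1 else 0)"
      unfolding op_trace_def
      by (rule infsum_cong) (simp add: E cinner_scaleC_right cinner_ket_left coord_ket)
    also have "\<dots> = (\<Sum>\<^sub>\<infinity>i\<in>{k}. 1)"
      by (rule infsum_cong_neutral) auto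
    finally show ?thesis by simp
  qed
  with bE mat that show thesis by blast
qed

text \<open>The Schur multiplier fixes the projection onto \<open>e\<^sub>k\<close>, which has norm 1 in every Schatten class.\<close>

lemma schur_norm_matrix_unit:
  assumes "0 < p" "0 < q"
  shows "1 \<le> schur_norm p q (matrix_unit (k :: 'a))"
proof (cases "schur_maps p q (matrix_unit k)")
  case True
  obtain E :: "'a operator" where E: "E \<in> bounded_operators" "\<And>i j. matrix_of E i j = matrix_unit k i j"
      "\<And>p. 0 < p \<Longrightarrow> trace_abs_powr p E = 1"
    by (rule rank_one_projection[of k]) blast
  have "schur_multiplier (matrix_unit k) E = E"
    by (rule schur_multiplier_eqI[OF E(1)]) (simp add: E(2), simp add: matrix_unit_def)
  then have "ennreal (schatten_norm q (schur_multiplier (matrix_unit k) E)) = 1"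
    using assms by (simp add: schatten_norm_def E)
  moreover have "E \<in> {x \<in> schatten_class p. schatten_norm p x \<le> 1}"
    using assms E by (simp add: schatten_class_def schatten_norm_def)
  ultimately show ?thesis
    unfolding schur_norm_def using True by (auto intro: SUP_upper2)
qed (simp add: schur_norm_def)

(* The index set X is the universe of 'a. The first conjunct is the asserted inequality for X = 'a.
   The second one states that the constant does not depend on X: HOL cannot quantify over types
   after c, so a constant valid for X = nat (one exists, by the first conjunct) is asserted to be
   valid for every X. *)
theorem theorem1p7:
  fixes p q :: real and r :: ereal
  assumes "1 < p" and "p \<le> 2" and "2 \<le> q"
    and "1 < r" and "1 / r = ereal (1 / p - 1 / q)"
  shows "(\<exists>c::real. \<forall>a :: 'a \<Rightarrow> 'a \<Rightarrow> complex.
             schur_norm p q a \<le> ennreal c * weak_norm r a) \<and>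
         (\<forall>c::real. (\<forall>a :: nat \<Rightarrow> nat \<Rightarrow> complex.
             schur_norm p q a \<le> ennreal c * weak_norm r a) \<longrightarrow>
           (\<forall>a :: 'a \<Rightarrow> 'a \<Rightarrow> complex.
             schur_norm p q a \<le> ennreal c * weak_norm r a))"
proof -
  have main: "schur_norm p q a \<le> weak_norm r a" for a :: "'a \<Rightarrow> 'a \<Rightarrow> complex"
    using assms by (intro schur_norm_le_weak_norm) auto
  show ?thesis
  proof (intro conjI exI[of _ 1] allI impI)
    fix a :: "'a \<Rightarrow> 'a \<Rightarrow> complex"
    show "schur_norm p q a \<le> ennreal 1 * weak_norm r a"
      using main[of a] by simp
  next
    fix c :: real and a :: "'a \<Rightarrow> 'a \<Rightarrow> complex"
    assume c: "\<forall>a :: nat \<Rightarrow> nat \<Rightarrow> complex. schur_norm p q a \<le> ennreal c * weak_norm r a"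
    \<comment> \<open>The symbol with a single entry shows that \<open>c \<ge> 1\<close>.\<close>
    have "1 \<le> schur_norm p q (matrix_unit (0 :: nat))"
      using assms by (intro schur_norm_matrix_unit) auto
    also have "\<dots> \<le> ennreal c * weak_norm r (matrix_unit (0 :: nat))"
      using c by blast
    also have "\<dots> \<le> ennreal c * 1"
      by (intro mult_left_mono weak_norm_matrix_unit assms) simp
    finally have "1 \<le> ennreal c" by simp
    then have "1 * weak_norm r a \<le> ennreal c * weak_norm r a"
      by (rule mult_right_mono) simp
    with main[of a] show "schur_norm p q a \<le> ennreal c * weak_norm r a" by simp
  qed
qed

end
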